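(* Every COM of rank $2$ has a corner peeling.
   Context: Hypercube $Q_n$: vertex set $\{+,-\}^n$, adjacency = differing in one coordinate; $-v$ is $v$ with all coordinates flipped. A partial cube is an isometric subgraph $G$ of $Q_n$ with $n$ minimal; its edges split into $\Theta$-classes. Convex subgraph: contains all shortest paths between its vertices; gated: every vertex $x$ has a vertex $x'$ of the subgraph on a shortest path from $x$ to each of its vertices. Antipodal: $v\in G\Rightarrow -v\in G$; antipodal subgraph: convex subgraph that is an antipodal partial cube. Rank: largest $r$ with $Q_r$ obtained by successively contracting all edges of $\Theta$-classes. A COM is a partial cube all of whose antipodal subgraphs are gated; an OM is an antipodal COM. Expansion of a partial cube $H$: a partial cube $G'$ with a $\Theta$-class $E$ whose contraction gives $H$, described by the images $H_1,H_2$ of the halfspaces $E^+,E^-$. For OMs $H,G'$ it is in general position if every maximal proper antipodal subgraph of $H$ lies in $H_1$ or $H_2$ but not in $H_1\cap H_2$; then $H\setminus H_1$ is a corner of $H$. A vertex set $C$ of a COM $G$ is a corner if it is contained in a unique maximal antipodal subgraph $H$ of $G$ (no other maximal antipodal subgraph meets $C$) and is a corner of the OM $H$. A corner peeling of $G$ is an ordered partition $C_1,\dots,C_k$ of $V(G)$ such that each $C_i$ is a corner of the subgraph induced by $V(G)\setminus(C_1\cup\dots\cup C_{i-1})$.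
   Formalization: In an OM of rank at most 1 (a single vertex or an edge) every single vertex is counted as a corner; with corners only from general-position expansions such OMs have no nonempty corner and no peeling could end (e.g. for the 4-cycle). *)

theory Defs
  imports Main
begin

text \<open>Vertices of the hypercube on a finite coordinate set E are encoded as subsets
  x \<subseteq> E (the set of coordinates carrying sign +). A (sub)graph is given by its
  vertex set; edges are those of the induced subgraph of the hypercube.\<close>

definition hdist :: "'a set \<Rightarrow> 'a set \<Rightarrow> nat" where
  "hdist x y = card ((x - y) \<union> (y - x))"

definition adj :: "'a set \<Rightarrow> 'a set \<Rightarrow> bool" where
  "adj x y \<longleftrightarrow> hdist x y = 1"

definition walk :: "'a set set \<Rightarrow> 'a set list \<Rightarrow> 'a set \<Rightarrow> 'a set \<Rightarrow> bool" where
  "walk V p x y \<longleftrightarrow> p \<noteq> [] \<and> set p \<subseteq> V \<and> hd p = x \<and> last p = y \<and> successively adj p"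

definition gdist :: "'a set set \<Rightarrow> 'a set \<Rightarrow> 'a set \<Rightarrow> nat" where
  "gdist V x y = (LEAST n. \<exists>p. walk V p x y \<and> length p = Suc n)"

definition geodesic :: "'a set set \<Rightarrow> 'a set list \<Rightarrow> 'a set \<Rightarrow> 'a set \<Rightarrow> bool" where
  "geodesic V p x y \<longleftrightarrow> walk V p x y \<and> length p = Suc (gdist V x y)"

definition isometric :: "'a set set \<Rightarrow> bool" where
  "isometric V \<longleftrightarrow> (\<forall>x\<in>V. \<forall>y\<in>V. (\<exists>p. walk V p x y) \<and> gdist V x y = hdist x y)"

text \<open>Partial cube: a nonempty isometric subgraph of the hypercube on E, with E minimal
  (every coordinate is non-constant, i.e. defines a Theta-class).\<close>
definition partial_cube :: "'a set \<Rightarrow> 'a set set \<Rightarrow> bool" where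
  "partial_cube E V \<longleftrightarrow> finite E \<and> V \<noteq> {} \<and> V \<subseteq> Pow E \<and> isometric V \<and>
     (\<forall>e\<in>E. \<exists>x\<in>V. \<exists>y\<in>V. e \<in> x \<and> e \<notin> y)"

definition antipodal :: "'a set \<Rightarrow> 'a set set \<Rightarrow> bool" where
  "antipodal E V \<longleftrightarrow> (\<forall>v\<in>V. E - v \<in> V)"

text \<open>Coordinates that vary on S (the minimal embedding of the subgraph S).\<close>
definition coords :: "'a set set \<Rightarrow> 'a set" where
  "coords S = {e. \<exists>x\<in>S. \<exists>y\<in>S. e \<in> x \<and> e \<notin> y}"

definition restr :: "'a set set \<Rightarrow> 'a set set" where
  "restr S = (\<lambda>x. x \<inter> coords S) ` S"

definition convex :: "'a set set \<Rightarrow> 'a set set \<Rightarrow> bool" where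
  "convex V S \<longleftrightarrow> S \<subseteq> V \<and> (\<forall>x\<in>S. \<forall>y\<in>S. \<forall>p. geodesic V p x y \<longrightarrow> set p \<subseteq> S)"

definition gated :: "'a set set \<Rightarrow> 'a set set \<Rightarrow> bool" where
  "gated V S \<longleftrightarrow> (\<forall>x\<in>V. \<exists>x'\<in>S. \<forall>y\<in>S. \<exists>p. geodesic V p x y \<and> x' \<in> set p)"

definition antipodal_subgraph :: "'a set set \<Rightarrow> 'a set set \<Rightarrow> bool" where
  "antipodal_subgraph V S \<longleftrightarrow> convex V S \<and> partial_cube (coords S) (restr S) \<and>
     antipodal (coords S) (restr S)"

definition COM :: "'a set \<Rightarrow> 'a set set \<Rightarrow> bool" where
  "COM E V \<longleftrightarrow> partial_cube E V \<and> (\<forall>S. antipodal_subgraph V S \<longrightarrow> gated V S)"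

definition OM :: "'a set \<Rightarrow> 'a set set \<Rightarrow> bool" where
  "OM E V \<longleftrightarrow> COM E V \<and> antipodal E V"

text \<open>Rank: contracting the Theta-classes E - B yields the image x \<mapsto> x \<inter> B;
  the rank is the largest |B| for which this image is the full hypercube on B.\<close>
definition rank :: "'a set \<Rightarrow> 'a set set \<Rightarrow> nat" where
  "rank E V = Max {card B | B. B \<subseteq> E \<and> (\<lambda>x. x \<inter> B) ` V = Pow B}"

definition expansion :: "'a set \<Rightarrow> 'a set set \<Rightarrow> 'a option set set \<Rightarrow> bool" where
  "expansion E V G' \<longleftrightarrow> partial_cube (insert None (Some ` E)) G' \<and> (\<lambda>x. Some -` x) ` G' = V"

definition exp_H1 :: "'a option set set \<Rightarrow> 'a set set" where
  "exp_H1 G' = (\<lambda>x. Some -` x) ` {x\<in>G'. None \<in> x}"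

definition exp_H2 :: "'a option set set \<Rightarrow> 'a set set" where
  "exp_H2 G' = (\<lambda>x. Some -` x) ` {x\<in>G'. None \<notin> x}"

definition max_proper_antipodal :: "'a set set \<Rightarrow> 'a set set \<Rightarrow> bool" where
  "max_proper_antipodal V S \<longleftrightarrow> antipodal_subgraph V S \<and> S \<noteq> V \<and>
     (\<forall>T. antipodal_subgraph V T \<and> T \<noteq> V \<and> S \<subseteq> T \<longrightarrow> T = S)"

definition general_position :: "'a set set \<Rightarrow> 'a option set set \<Rightarrow> bool" where
  "general_position V G' \<longleftrightarrow> (\<forall>S. max_proper_antipodal V S \<longrightarrow>
     ((S \<subseteq> exp_H1 G' \<or> S \<subseteq> exp_H2 G') \<and> \<not> S \<subseteq> exp_H1 G' \<inter> exp_H2 G'))"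

definition OM_corner :: "'a set \<Rightarrow> 'a set set \<Rightarrow> 'a set set \<Rightarrow> bool" where
  "OM_corner E V C \<longleftrightarrow> OM E V \<and>
     ((\<exists>G'. OM (insert None (Some ` E)) G' \<and> expansion E V G' \<and> general_position V G' \<and>
            C = V - exp_H1 G')
      \<or> (rank E V \<le> 1 \<and> (\<exists>v\<in>V. C = {v})))"

definition max_antipodal :: "'a set set \<Rightarrow> 'a set set \<Rightarrow> bool" where
  "max_antipodal V H \<longleftrightarrow> antipodal_subgraph V H \<and>
     (\<forall>T. antipodal_subgraph V T \<and> H \<subseteq> T \<longrightarrow> T = H)"

definition COM_corner :: "'a set set \<Rightarrow> 'a set set \<Rightarrow> bool" where
  "COM_corner V C \<longleftrightarrow> (\<exists>H. max_antipodal V H \<and> C \<subseteq> H \<and>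
     (\<forall>H'. max_antipodal V H' \<and> H' \<noteq> H \<longrightarrow> H' \<inter> C = {}) \<and>
     OM_corner (coords H) (restr H) ((\<lambda>x. x \<inter> coords H) ` C))"

definition corner_peeling :: "'a set set \<Rightarrow> 'a set set list \<Rightarrow> bool" where
  "corner_peeling V Cs \<longleftrightarrow>
     (\<forall>C\<in>set Cs. C \<noteq> {}) \<and>
     (\<forall>i<length Cs. \<forall>j<length Cs. i \<noteq> j \<longrightarrow> Cs ! i \<inter> Cs ! j = {}) \<and>
     \<Union>(set Cs) = V \<and>
     (\<forall>i<length Cs. COM_corner (V - \<Union>(set (take i Cs))) (Cs ! i))"

end

theory Submission
  imports Defs
begin

text \<open>An antipodal subgraph with coordinate set K is a fibre of the map that deletes K, and it is gated
  iff every vertex of V keeps its K-part when projected to it. In rank 2 the cells are vertices,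
  edges and even cycles, and an interval between two f-edges with no f-edge in between
  spans a cell.

  To find a corner, start with an inclusion-minimal halfspace R of a class f: every class crossing R
  crosses the f-edges of R, and these form a tree. At a leaf of this tree take the cell containing
  the leaf edge and the path P of this cell in R, without its last vertex. If no
  vertex of P has further vertices of V projecting onto it, P is a corner. Otherwise the set of vertices
  projecting onto the first bad vertex of P is a smaller region of the same kind, now with respect to
  the class of the next edge of the path, so the descent ends. Since the vertices of a corner are
  the only ones projecting onto it, removing it preserves isometry, gatedness and
  the rank bound.\<close>

subsection \<open>Cells spanned by edges of one class\<close>

text \<open>The last vertex \<open>z\<close> of the path is kept because a corner of a cycle with 2n
  vertices has n - 1 vertices: what remains must be a path joining two antipodal vertices, here
  \<open>flip f a\<close> and \<open>z\<close>, so that it overlaps its antipodal path in exactly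
  its two ends. The obstacle is that the path of a leaf cell may have further vertices of V behind
  it. The region behind its first bad vertex is smaller, but it need not be a halfspace: edges at
  the bad vertex itself lead back along the path. So the descent has to tolerate one exceptional
  exit vertex, and the next leaf must avoid it. A second edge of the current class is thus needed as
  soon as the region has a second vertex. This is what the crossing condition provides. For the
  first region it comes from minimality of the halfspace; it passes to the next region because both
  values of a crossing class also occur behind \<open>z\<close>.\<close>

definition sd :: "'a set \<Rightarrow> 'a set \<Rightarrow> 'a set" where
  "sd x y = (x - y) \<union> (y - x)"

definition flip :: "'a \<Rightarrow> 'a set \<Rightarrow> 'a set" where
  "flip e x = sd x {e}"

lemma mem_sd [simp]: "k \<in> sd x y \<longleftrightarrow> (k \<in> x) \<noteq> (k \<in> y)"
  by (auto simp: sd_def)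

lemma mem_flip [simp]: "k \<in> flip e x \<longleftrightarrow> (k \<in> x) \<noteq> (k = e)"
  by (auto simp: flip_def)

lemma flip_flip [simp]: "flip e (flip e x) = x"
  by auto

lemma flip_neq [simp]: "flip e x \<noteq> x" "x \<noteq> flip e x"
  by (auto simp: set_eq_iff)

lemma finite_sd [simp]: "finite x \<Longrightarrow> finite y \<Longrightarrow> finite (sd x y)"
  by (simp add: sd_def)

lemma finite_flip [simp]: "finite (flip e x) \<longleftrightarrow> finite x"
  by (auto simp: flip_def sd_def intro: finite_subset[of x "insert e (x - {e})"])

lemma sd_neq_empty: "x \<noteq> y \<Longrightarrow> \<exists>e. e \<in> sd x y"
  by auto

lemma card_sd_flip:
  assumes "finite (sd x y)" "e \<in> sd x y"
  shows "finite (sd (flip e x) y)" "card (sd x y) = Suc (card (sd (flip e x) y))"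
proof -
  have "sd (flip e x) y = sd x y - {e}"
    using assms(2) by auto
  then show "finite (sd (flip e x) y)" "card (sd x y) = Suc (card (sd (flip e x) y))"
    using assms card_Suc_Diff1[of "sd x y" e] by (simp_all del: mem_sd)
qed

text \<open>The interval of the hypercube, in pointwise form. For isometric \<open>V\<close> it
  describes the vertices on geodesics (\<open>geodesic_through_iff\<close>).\<close>

definition btw :: "'a set \<Rightarrow> 'a set \<Rightarrow> 'a set \<Rightarrow> bool" where
  "btw x z y \<longleftrightarrow> (\<forall>k. (k \<in> x) = (k \<in> y) \<longrightarrow> (k \<in> z) = (k \<in> x))"

lemma btwI: "(\<And>k. (k \<in> x) = (k \<in> y) \<Longrightarrow> (k \<in> z) = (k \<in> x)) \<Longrightarrow> btw x z y"
  by (simp add: btw_def)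

lemma btwD: "btw x z y \<Longrightarrow> (k \<in> x) = (k \<in> y) \<Longrightarrow> (k \<in> z) = (k \<in> x)"
  by (simp add: btw_def)

lemma btw_flip:
  assumes "e \<in> sd x y"
  shows "btw x (flip e x) y"
proof (rule btwI)
  fix k assume "(k \<in> x) = (k \<in> y)"
  then have "k \<noteq> e"
    using assms by auto
  then show "(k \<in> flip e x) = (k \<in> x)"
    by simp
qed

lemma btw_btw:
  assumes "btw y w1 c" "btw y w2 c" "btw w1 w w2"
  shows "btw y w c"
  by (rule btwI) (metis assms btwD)

text \<open>Isometry without walks: there is always a neighbour one step closer to the target. For
  finite vertices this is equivalent to \<open>isometric\<close>
  (\<open>isometric_iff_iso\<close>).\<close>

definition iso :: "'a set set \<Rightarrow> bool" where
  "iso V \<longleftrightarrow> (\<forall>x\<in>V. \<forall>y\<in>V. x \<noteq> y \<longrightarrow> (\<exists>e\<in>sd x y. flip e x \<in> V))"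

definition conv :: "'a set set \<Rightarrow> 'a set set \<Rightarrow> bool" where
  "conv V S \<longleftrightarrow> S \<subseteq> V \<and> (\<forall>x\<in>S. \<forall>y\<in>S. \<forall>z\<in>V. btw x z y \<longrightarrow> z \<in> S)"

text \<open>Encodes an antipodal subgraph by a vertex and its classes \<open>K\<close>. Fibres are
  convex anyway, so closure under antipodes is all that has to be asked; see
  \<open>antipodal_subgraph_fibre\<close> and \<open>antipodal_subgraphE\<close>.\<close>

definition cell :: "'a set set \<Rightarrow> 'a set \<Rightarrow> 'a set \<Rightarrow> bool" where
  "cell V x K \<longleftrightarrow> x \<in> V \<and> (\<forall>y\<in>V. y - K = x - K \<longrightarrow> sd y K \<in> V)"

definition shatters2 :: "'a set set \<Rightarrow> 'a \<Rightarrow> 'a \<Rightarrow> bool" where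
  "shatters2 V a b \<longleftrightarrow> (\<forall>p q. \<exists>x\<in>V. (a \<in> x) = p \<and> (b \<in> x) = q)"

text \<open>For distinct coordinates this says that contracting all other classes leaves the full
  cube \<open>Q_3\<close>, so rank at most 2 forbids it.\<close>

definition shatters3 :: "'a set set \<Rightarrow> 'a \<Rightarrow> 'a \<Rightarrow> 'a \<Rightarrow> bool" where
  "shatters3 V a b c \<longleftrightarrow> (\<forall>p q r. \<exists>x\<in>V. (a \<in> x) = p \<and> (b \<in> x) = q \<and> (c \<in> x) = r)"

definition crosses :: "'a \<Rightarrow> 'a set set \<Rightarrow> bool" where
  "crosses k A \<longleftrightarrow> (\<exists>x\<in>A. \<exists>y\<in>A. k \<in> x \<and> k \<notin> y)"

lemma shatters2I:
  assumes "x1 \<in> A" "x2 \<in> A" "x3 \<in> A" "x4 \<in> A"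
    and "(k \<in> x1) = b" "(l \<in> x1) = c" "(k \<in> x2) = b" "(l \<in> x2) = (\<not> c)"
      "(k \<in> x3) = (\<not> b)" "(l \<in> x3) = c" "(k \<in> x4) = (\<not> b)" "(l \<in> x4) = (\<not> c)"
  shows "shatters2 A k l"
  unfolding shatters2_def
proof (intro allI)
  fix p q
  show "\<exists>x\<in>A. (k \<in> x) = p \<and> (l \<in> x) = q"
    using assms by (cases "p = b"; cases "q = c") blast+
qed

section \<open>Basic facts on isometric and convex sets\<close>

lemma isoD: "iso V \<Longrightarrow> x \<in> V \<Longrightarrow> y \<in> V \<Longrightarrow> x \<noteq> y \<Longrightarrow> \<exists>e\<in>sd x y. flip e x \<in> V"
  by (auto simp: iso_def)

lemma convD: "conv V S \<Longrightarrow> x \<in> S \<Longrightarrow> y \<in> S \<Longrightarrow> z \<in> V \<Longrightarrow> btw x z y \<Longrightarrow> z \<in> S"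
  unfolding conv_def by blast

lemma convI:
  "S \<subseteq> V \<Longrightarrow> (\<And>x y z. x \<in> S \<Longrightarrow> y \<in> S \<Longrightarrow> z \<in> V \<Longrightarrow> btw x z y \<Longrightarrow> z \<in> S) \<Longrightarrow> conv V S"
  unfolding conv_def by blast

lemma conv_subset: "conv V S \<Longrightarrow> S \<subseteq> V"
  by (simp add: conv_def)

lemma conv_iso:
  assumes "iso V" "conv V S"
  shows "iso S"
  unfolding iso_def
proof (intro ballI impI)
  fix x y assume xy: "x \<in> S" "y \<in> S" "x \<noteq> y"
  then obtain e where e: "e \<in> sd x y" "flip e x \<in> V"
    using isoD[OF assms(1), of x y] conv_subset[OF assms(2)] by blast
  then have "btw x (flip e x) y"
    by (intro btw_flip)
  then show "\<exists>e\<in>sd x y. flip e x \<in> S"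
    using convD[OF assms(2) xy(1,2)] e by blast
qed

lemma conv_interval: "conv V {w \<in> V. btw x w y}"
  by (rule convI) (auto intro: btw_btw)

lemma conv_Int:
  assumes S: "conv V S"
  shows "conv V {x \<in> S. x \<inter> K = y \<inter> K}"
proof (rule convI)
  show "{x \<in> S. x \<inter> K = y \<inter> K} \<subseteq> V"
    using conv_subset[OF S] by blast
  fix x1 x2 z
  assume x: "x1 \<in> {x \<in> S. x \<inter> K = y \<inter> K}" "x2 \<in> {x \<in> S. x \<inter> K = y \<inter> K}"
    and z: "z \<in> V" "btw x1 z x2"
  have "(k \<in> z) = (k \<in> y)" if "k \<in> K" for k
    using x btwD[OF z(2), of k] that by blast
  then show "z \<in> {x \<in> S. x \<inter> K = y \<inter> K}"
    using convD[OF S _ _ z] x by blast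
qed

lemma conv_halfspace:
  assumes S: "conv V S"
  shows "conv V {x \<in> S. (k \<in> x) = b}"
proof (rule convI)
  show "{x \<in> S. (k \<in> x) = b} \<subseteq> V"
    using conv_subset[OF S] by blast
  fix x1 x2 z
  assume x: "x1 \<in> {x \<in> S. (k \<in> x) = b}" "x2 \<in> {x \<in> S. (k \<in> x) = b}"
    and z: "z \<in> V" "btw x1 z x2"
  then show "z \<in> {x \<in> S. (k \<in> x) = b}"
    using convD[OF S _ _ z] btwD[OF z(2), of k] by blast
qed

lemma iso_exit:
  assumes "iso S" "finite (sd x y)" "x \<in> S" "y \<in> S" "P x" "\<not> P y"
  shows "\<exists>u e. u \<in> S \<and> P u \<and> flip e u \<in> S \<and> \<not> P (flip e u)"
  using assms(2-)
proof (induction "card (sd x y)" arbitrary: x rule: less_induct)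
  case less
  then have "x \<noteq> y"
    by auto
  then obtain e where e: "e \<in> sd x y" "flip e x \<in> S"
    using isoD[OF assms(1)] less.prems by blast
  show ?case
  proof (cases "P (flip e x)")
    case True
    then show ?thesis
      using less.hyps[of "flip e x"] less.prems e card_sd_flip[OF less.prems(1) e(1)] by auto
  next
    case False
    then show ?thesis
      using e less.prems by blast
  qed
qed

lemma iso_edge:
  assumes "iso S" "finite (sd x y)" "x \<in> S" "y \<in> S" "(h \<in> x) \<noteq> (h \<in> y)"
  shows "\<exists>u\<in>S. (h \<in> u) = (h \<in> x) \<and> flip h u \<in> S"
proof -
  obtain u e where "u \<in> S" "(h \<in> u) = (h \<in> x)" "flip e u \<in> S" "(h \<in> flip e u) \<noteq> (h \<in> x)"
    using iso_exit[OF assms(1-4), of "\<lambda>u. (h \<in> u) = (h \<in> x)"] assms(5) by auto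
  then show ?thesis
    by (metis mem_flip)
qed

text \<open>The antipode of \<open>y\<close> appears across \<open>f\<close> as a switching point. A
  vertex \<open>c\<close> between \<open>flip f a\<close> and \<open>flip f z\<close> is reached
  from \<open>y\<close> through \<open>a\<close> or through \<open>z\<close>. In the first case no
  class of \<open>sd a z\<close> is left by both \<open>y\<close> and \<open>c\<close>; in the
  second every class is left by at least one of them. A shortest walk between the two ends switches
  from the first case to the second, and just before the switch \<open>c\<close> is complementary to
  \<open>y\<close>.\<close>

lemma cell_interval_half:
  assumes V: "iso V" "\<And>x. x \<in> V \<Longrightarrow> finite x"
    and az: "a \<in> V" "z \<in> V" "flip f a \<in> V" "flip f z \<in> V" "(f \<in> a) = (f \<in> z)"
    and only: "\<And>w. w \<in> V \<Longrightarrow> btw a w z \<Longrightarrow> flip f w \<in> V \<Longrightarrow> w = a \<or> w = z"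
    and y: "y \<in> V" "btw a y z"
  shows "sd y (insert f (sd a z)) \<in> V"
proof -
  define S where "S = {c \<in> V. btw (flip f a) c (flip f z)}"
  have isoS: "iso S"
    unfolding S_def by (rule conv_iso[OF V(1) conv_interval])
  define P where "P c \<longleftrightarrow> (\<forall>k\<in>sd a z. (k \<in> y) \<noteq> (k \<in> a) \<longrightarrow> (k \<in> c) = (k \<in> a))" for c
  \<comment> \<open>A geodesic from y to c crosses f inside the interval, so it passes through a or z.\<close>
  have disj: "P c \<or> (\<forall>k\<in>sd a z. (k \<in> y) \<noteq> (k \<in> a) \<or> (k \<in> c) \<noteq> (k \<in> a))" if c: "c \<in> S" for c
  proof -
    let ?T = "{w \<in> V. btw y w c}"
    have "c \<in> V" "(f \<in> y) \<noteq> (f \<in> c)"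
      using c y(2) az(5) by (auto simp: S_def btw_def)
    then obtain u where u: "u \<in> ?T" "(f \<in> u) = (f \<in> y)" "flip f u \<in> ?T"
      using iso_edge[OF conv_iso[OF V(1) conv_interval[of V y c]], of y c f] y(1) V(2)
      by (auto simp: btw_def)
    have "(k \<in> u) = (k \<in> a)" if k: "(k \<in> a) = (k \<in> z)" for k
    proof (cases "k = f")
      case True
      then show ?thesis
        using u y(2) az(5) by (auto simp: btw_def)
    next
      case False
      then have "(k \<in> y) = (k \<in> a)" "(k \<in> c) = (k \<in> a)"
        using k y(2) c by (auto simp: btw_def S_def)
      then show ?thesis
        using u(1) by (auto simp: btw_def)
    qed
    then have "btw a u z"
      by (simp add: btw_def)
    then have "u = a \<or> u = z"
      using only u by auto
    then show ?thesis
    proof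
      assume "u = a"
      then have "btw y a c"
        using u by auto
      then have "P c"
        unfolding P_def btw_def by blast
      then show ?thesis ..
    next
      assume "u = z"
      then have "btw y z c"
        using u by auto
      then have "(k \<in> y) \<noteq> (k \<in> a) \<or> (k \<in> c) \<noteq> (k \<in> a)" if "k \<in> sd a z" for k
        using btwD[of y z c k] that by auto
      then show ?thesis
        by blast
    qed
  qed
  have ends: "flip f a \<in> S" "flip f z \<in> S"
    using az by (auto simp: S_def btw_def)
  have "P (flip f a)"
    using az(5) by (auto simp: P_def)
  show ?thesis
  proof (cases "P (flip f z)")
    case True
    \<comment> \<open>Degenerate case: the antipode is the end \<open>flip f z\<close>
      itself.\<close>
    then have "y = a"
      using y(2) az(5) unfolding P_def btw_def by fastforce
    then have "sd y (insert f (sd a z)) = flip f z"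
      using az(5) by auto
    then show ?thesis
      using az by simp
  next
    case False
    then obtain c m where c: "c \<in> S" "P c" "flip m c \<in> S" "\<not> P (flip m c)"
      using iso_exit[OF isoS _ ends, of P] \<open>P (flip f a)\<close> V(2) az by auto
    then have cover: "\<forall>k\<in>sd a z. (k \<in> y) \<noteq> (k \<in> a) \<or> (k \<in> flip m c) \<noteq> (k \<in> a)"
      using disj by blast
    have m: "m \<in> sd a z" "(m \<in> y) \<noteq> (m \<in> a)"
      using c unfolding P_def by (metis mem_flip)+
    have "k \<in> sd y (insert f (sd a z)) \<longleftrightarrow> k \<in> c" for k
    proof (cases "k \<in> sd a z")
      case True
      then have "k \<noteq> f"
        using az(5) by auto
      moreover have "((k \<in> y) \<noteq> (k \<in> a)) \<noteq> ((k \<in> c) \<noteq> (k \<in> a))"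
        using True cover c(2) m unfolding P_def by (cases "k = m") auto
      ultimately show ?thesis
        using True by auto
    next
      case False
      then show ?thesis
        using c(1) y(2) az(5) by (cases "k = f") (auto simp: S_def btw_def)
    qed
    then have "sd y (insert f (sd a z)) = c"
      by blast
    then show ?thesis
      using c(1) by (simp add: S_def)
  qed
qed

text \<open>The fibre consists of one interval on each side of \<open>f\<close>; moving both ends
  across \<open>f\<close> exchanges the two, so the half result covers each.\<close>

lemma cell_interval:
  assumes V: "iso V" "\<And>x. x \<in> V \<Longrightarrow> finite x"
    and az: "a \<in> V" "z \<in> V" "flip f a \<in> V" "flip f z \<in> V" "(f \<in> a) = (f \<in> z)"
    and only: "\<And>w. w \<in> V \<Longrightarrow> btw a w z \<Longrightarrow> flip f w \<in> V \<Longrightarrow> w = a \<or> w = z"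
  shows "cell V a (insert f (sd a z))"
  unfolding cell_def
proof (intro conjI ballI impI)
  show "a \<in> V" by fact
  fix y assume y: "y \<in> V" "y - insert f (sd a z) = a - insert f (sd a z)"
  have eq: "(k \<in> y) = (k \<in> a)" if "k \<noteq> f" "(k \<in> a) = (k \<in> z)" for k
    using y(2) that by (auto simp: set_eq_iff)
  show "sd y (insert f (sd a z)) \<in> V"
  proof (cases "(f \<in> y) = (f \<in> a)")
    case True
    then have "btw a y z"
      using eq unfolding btw_def by metis
    then show ?thesis
      using cell_interval_half[OF assms y(1)] by blast
  next
    case False
    have "w = flip f a \<or> w = flip f z"
      if "w \<in> V" "btw (flip f a) w (flip f z)" "flip f w \<in> V" for w
    proof -
      have "btw a (flip f w) z"
        using that(2) az(5) unfolding btw_def mem_flip by metis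
      then have "flip f w = a \<or> flip f w = z"
        using only[of "flip f w"] that by auto
      then show ?thesis
        by auto
    qed
    moreover have "btw (flip f a) y (flip f z)"
      using eq False az(5) unfolding btw_def mem_flip by metis
    moreover have "sd (flip f a) (flip f z) = sd a z"
      by auto
    ultimately show ?thesis
      using cell_interval_half[of V "flip f a" "flip f z" f y] V az y(1) by auto
  qed
qed

text \<open>Without shattered pairs \<open>W\<close> behaves like a tree. Take \<open>g\<close> such
  that the part of \<open>W\<close> separated from \<open>p\<close> by \<open>g\<close> is nonempty
  and smallest. Two elements of this part are separated by some \<open>h\<close>; by minimality the
  part of \<open>h\<close> is not contained in that of \<open>g\<close>, and then all four patterns
  of \<open>g\<close> and \<open>h\<close> occur.\<close>

lemma leaf_exists:
  assumes W: "finite W" "p \<in> W" "q \<in> W" "q \<noteq> p"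
    and rank1: "\<And>g h. g \<noteq> h \<Longrightarrow> \<not> shatters2 W g h"
  shows "\<exists>a\<in>W. a \<noteq> p \<and> (\<exists>g. \<forall>w\<in>W. w \<noteq> a \<longrightarrow> (g \<in> w) \<noteq> (g \<in> a))"
proof -
  define U where "U g = {w \<in> W. (g \<in> w) \<noteq> (g \<in> p)}" for g
  have fU: "finite (U g)" for g
    using W by (simp add: U_def)
  obtain g0 where "U g0 \<noteq> {}"
    using W by (auto simp: U_def set_eq_iff)
  then obtain g where g: "U g \<noteq> {}" and min: "\<And>h. U h \<noteq> {} \<Longrightarrow> card (U g) \<le> card (U h)"
    using ex_has_least_nat[of "\<lambda>g. U g \<noteq> {}" g0 "\<lambda>g. card (U g)"] by blast
  then obtain a where a: "a \<in> U g"
    by blast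
  have "w = a" if w: "w \<in> U g" for w
  proof (rule ccontr)
    assume "w \<noteq> a"
    then obtain h where h: "(h \<in> w) \<noteq> (h \<in> a)"
      by blast
    obtain v1 v2 where v: "v1 \<in> U g" "v2 \<in> U g" "v1 \<in> U h" "v2 \<notin> U h"
      using a w h by (cases "a \<in> U h") (auto simp: U_def)
    have "\<not> U h \<subseteq> U g"
    proof
      assume "U h \<subseteq> U g"
      then have "U h \<subset> U g"
        using v by blast
      then have "card (U h) < card (U g)"
        by (rule psubset_card_mono[OF fU])
      moreover have "U h \<noteq> {}"
        using v by blast
      ultimately show False
        using min[of h] by linarith
    qed
    then obtain v3 where "v3 \<in> U h" "v3 \<notin> U g"
      by blast
    then have pats: "\<exists>x\<in>W. (g \<in> x) = b \<and> (h \<in> x) = c" for b c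
      using v W(2) unfolding U_def
      by (cases "b = (g \<in> p)"; cases "c = (h \<in> p)") blast+
    have "g \<noteq> h"
      using h a w by (auto simp: U_def)
    then show False
      using rank1 pats unfolding shatters2_def by blast
  qed
  then have "(g \<in> w) \<noteq> (g \<in> a)" if "w \<in> W" "w \<noteq> a" for w
    using a that unfolding U_def by blast
  moreover have "a \<in> W" "a \<noteq> p"
    using a by (auto simp: U_def)
  ultimately show ?thesis
    by blast
qed

subsection \<open>Existence of a free wedge or a pendant vertex\<close>

lemma conv_refl: "conv V V"
  by (simp add: conv_def)

lemma btw_refl [simp]: "btw x x y" "btw x y y"
  unfolding btw_def by auto

lemma crossesD: "crosses k A \<Longrightarrow> \<exists>x\<in>A. (k \<in> x) = b"
  unfolding crosses_def by (cases b) auto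

lemma crossesI: "x \<in> A \<Longrightarrow> y \<in> A \<Longrightarrow> (k \<in> x) \<noteq> (k \<in> y) \<Longrightarrow> crosses k A"
  unfolding crosses_def by blast

text \<open>In a cell with coordinates insert f (sd a z) whose only f-edges start at a and z, the arc
  is the path from a to z on one side of f, without z.\<close>

definition wedge :: "'a set set \<Rightarrow> 'a set \<Rightarrow> 'a set \<Rightarrow> 'a \<Rightarrow> bool" where
  "wedge V a z f \<longleftrightarrow> a \<in> V \<and> z \<in> V \<and> flip f a \<in> V \<and> flip f z \<in> V \<and> (f \<in> a) = (f \<in> z) \<and>
     a \<noteq> z \<and> cell V a (insert f (sd a z))"

definition arc :: "'a set set \<Rightarrow> 'a set \<Rightarrow> 'a set \<Rightarrow> 'a set set" where
  "arc V a z = {x \<in> V. btw a x z \<and> x \<noteq> z}"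

text \<open>Equal traces on the classes of the cell mean that \<open>y\<close> has gate
  \<open>x\<close>. So a free arc has no further vertices behind it.\<close>

definition free_wedge :: "'a set set \<Rightarrow> 'a set \<Rightarrow> 'a set \<Rightarrow> 'a \<Rightarrow> bool" where
  "free_wedge V a z f \<longleftrightarrow> wedge V a z f \<and>
     (\<forall>x\<in>arc V a z. \<forall>y\<in>V. y \<inter> insert f (sd a z) = x \<inter> insert f (sd a z) \<longrightarrow> y = x)"

definition pendant :: "'a set set \<Rightarrow> 'a set \<Rightarrow> 'a \<Rightarrow> bool" where
  "pendant V p f \<longleftrightarrow> p \<in> V \<and> flip f p \<in> V \<and> (\<forall>e. flip e p \<in> V \<longrightarrow> e = f)"

text \<open>The only possible gate of \<open>y\<close> in the fibre of \<open>a\<close>; gatedness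
  becomes membership of this set in \<open>V\<close> (\<open>gated_fibre_iff\<close>).\<close>

definition proj :: "'a set \<Rightarrow> 'a set \<Rightarrow> 'a set \<Rightarrow> 'a set" where
  "proj a K y = (y \<inter> K) \<union> (a - K)"

lemma mem_proj [simp]: "k \<in> proj a K y \<longleftrightarrow> (if k \<in> K then k \<in> y else k \<in> a)"
  by (simp add: proj_def)

lemma proj_flip: "e \<in> K \<Longrightarrow> proj a K (flip e y) = flip e (proj a K y)"
  by (rule set_eqI) auto

lemma proj_eq: "y \<inter> K = x \<inter> K \<Longrightarrow> x - K = a - K \<Longrightarrow> proj a K y = x"
  unfolding proj_def by blast

lemma btw_Diff:
  assumes "btw a x z" "sd a z \<subseteq> K"
  shows "x - K = a - K"
proof -
  have "(k \<in> x) = (k \<in> a)" if "k \<notin> K" for k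
    using btwD[OF assms(1), of k] assms(2) that by (meson mem_sd subsetD)
  then show ?thesis
    by blast
qed

lemma Int_eqD: "y \<inter> K = x \<inter> K \<Longrightarrow> k \<in> K \<Longrightarrow> (k \<in> y) = (k \<in> x)"
  by blast

lemma Int_eqI: "(\<And>k. k \<in> K \<Longrightarrow> (k \<in> y) = (k \<in> x)) \<Longrightarrow> y \<inter> K = x \<inter> K"
  by blast

locale com2 =
  fixes V :: "'a set set"
  assumes finite_V: "finite V"
    and finite_elem: "x \<in> V \<Longrightarrow> finite x"
    and iso_V: "iso V"
    and gate: "cell V x K \<Longrightarrow> z \<in> V \<Longrightarrow> proj x K z \<in> V"
    and rank2: "f \<noteq> g \<Longrightarrow> f \<noteq> h \<Longrightarrow> g \<noteq> h \<Longrightarrow> \<not> shatters3 V f g h"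
begin

section \<open>Rank 2 turns wedges into even cycles\<close>

lemma iso_conv: "conv V S \<Longrightarrow> iso S"
  using conv_iso iso_V by blast

text \<open>The \<open>f\<close>-neighbours repeat a shattered pair of \<open>W\<close> on the other
  side of \<open>f\<close>, which would give a shattered triple.\<close>

lemma edge_side_rank1:
  assumes "W \<subseteq> {y \<in> V. flip f y \<in> V \<and> (f \<in> y) = b}" "g \<noteq> h"
  shows "\<not> shatters2 W g h"
proof
  assume sh: "shatters2 W g h"
  have const: "(f \<in> x) = b" "x \<in> V" "flip f x \<in> V" if "x \<in> W" for x
    using assms(1) that by auto
  obtain x y where "x \<in> W" "(g \<in> x) = (\<not> b)" "y \<in> W" "(h \<in> y) = (\<not> b)"
    using sh unfolding shatters2_def by blast
  then have "f \<noteq> g" "f \<noteq> h"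
    using const(1) by auto
  have "\<exists>x\<in>V. (f \<in> x) = p \<and> (g \<in> x) = q \<and> (h \<in> x) = r" for p q r
  proof -
    obtain x where "x \<in> W" "(g \<in> x) = q" "(h \<in> x) = r"
      using sh unfolding shatters2_def by blast
    then show ?thesis
      using const[of x] \<open>f \<noteq> g\<close> \<open>f \<noteq> h\<close>
      by (intro bexI[of _ "if p = b then x else flip f x"]) auto
  qed
  then show False
    using rank2[of f g h] \<open>f \<noteq> g\<close> \<open>f \<noteq> h\<close> assms(2) unfolding shatters3_def by blast
qed

lemma wedge_opposite:
  assumes w: "wedge V a z f" and x: "x \<in> V" "btw a x z"
  shows "sd x (insert f (sd a z)) \<in> V"
proof -
  have "x - insert f (sd a z) = a - insert f (sd a z)"
    using btw_Diff[OF x(2)] by blast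
  then show ?thesis
    using w x unfolding wedge_def cell_def by blast
qed

text \<open>Antipodes in the cell would carry a shattered pair across \<open>f\<close>, again giving
  a shattered triple.\<close>

lemma wedge_not_shatters2:
  assumes w: "wedge V a z f" and kl: "k \<in> sd a z" "l \<in> sd a z" "k \<noteq> l"
  shows "\<not> shatters2 {t \<in> V. btw a t z} k l"
proof
  assume sh: "shatters2 {t \<in> V. btw a t z} k l"
  have fa: "(f \<in> a) = (f \<in> z)"
    using w by (simp add: wedge_def)
  then have "f \<noteq> k" "f \<noteq> l"
    using kl by auto
  have "\<exists>x\<in>V. (f \<in> x) = p \<and> (k \<in> x) = q \<and> (l \<in> x) = r" for p q r
  proof (cases "p = (f \<in> a)")
    case True
    obtain t where "t \<in> V" "btw a t z" "(k \<in> t) = q" "(l \<in> t) = r"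
      using sh unfolding shatters2_def by blast
    moreover have "(f \<in> t) = (f \<in> a)"
      using btwD[OF \<open>btw a t z\<close> fa] .
    ultimately show ?thesis
      using True by blast
  next
    case False
    obtain t where t: "t \<in> V" "btw a t z" "(k \<in> t) = (\<not> q)" "(l \<in> t) = (\<not> r)"
      using sh unfolding shatters2_def by blast
    moreover have "(f \<in> t) = (f \<in> a)"
      using btwD[OF \<open>btw a t z\<close> fa] .
    ultimately show ?thesis
      using False kl wedge_opposite[OF w t(1,2)]
      by (intro bexI[of _ "sd t (insert f (sd a z))"]) auto
  qed
  then show False
    using rank2[of f k l] \<open>f \<noteq> k\<close> \<open>f \<noteq> l\<close> kl unfolding shatters3_def by blast
qed

text \<open>The reason why the cell is a cycle: two vertices with incomparable difference sets
  would, together with \<open>a\<close> and \<open>z\<close>, shatter a pair. So the interval is a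
  single path from \<open>a\<close> to \<open>z\<close>.\<close>

lemma wedge_chain:
  assumes w: "wedge V a z f" and x: "x \<in> V" "btw a x z" and y: "y \<in> V" "btw a y z"
  shows "sd x a \<subseteq> sd y a \<or> sd y a \<subseteq> sd x a"
proof (rule ccontr)
  assume "\<not> ?thesis"
  then obtain k l where k: "k \<in> sd x a" "k \<notin> sd y a" and l: "l \<in> sd y a" "l \<notin> sd x a"
    by blast
  have kl: "k \<in> sd a z" "l \<in> sd a z"
    using btwD[OF x(2), of k] btwD[OF y(2), of l] k l by auto
  have az: "a \<in> V" "z \<in> V"
    using w by (auto simp: wedge_def)
  have "shatters2 {t \<in> V. btw a t z} k l"
    by (rule shatters2I[where b = "k \<in> a" and c = "l \<in> a" and ?x1.0 = a and ?x2.0 = y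
        and ?x3.0 = x and ?x4.0 = z])
      (use az x y k l kl in auto)
  then show False
    using wedge_not_shatters2[OF w kl] k l by blast
qed

lemma wedge_proj:
  assumes w: "wedge V a z f" and y: "y \<in> V" and K: "K = insert f (sd a z)"
  shows "proj a K y \<in> V"
  using gate w y K unfolding wedge_def by blast

lemma wedge_proj_btw:
  assumes w: "wedge V a z f" and y: "(f \<in> y) = (f \<in> a)" and K: "K = insert f (sd a z)"
  shows "btw a (proj a K y) z"
  using y by (auto simp: btw_def K)

text \<open>Crossing \<open>f\<close> and then passing to the antipode complements the difference
  set from \<open>a\<close> within \<open>sd a z\<close>. In a chain, a set and its complement are
  comparable only if one of them is empty.\<close>

lemma wedge_ends:
  assumes w: "wedge V a z f" and x: "x \<in> V" "btw a x z" "flip f x \<in> V"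
  shows "x = a \<or> x = z"
proof -
  let ?K = "insert f (sd a z)"
  have fa: "(f \<in> a) = (f \<in> z)" "(f \<in> x) = (f \<in> a)"
    using w btwD[OF x(2), of f] by (auto simp: wedge_def)
  have "flip f x - ?K = x - ?K"
    by auto
  also have "\<dots> = a - ?K"
    using btw_Diff[OF x(2), of ?K] by blast
  finally have "flip f x - ?K = a - ?K" .
  then have "sd (flip f x) ?K \<in> V"
    using w x unfolding wedge_def cell_def by blast
  moreover have "btw a (sd (flip f x) ?K) z"
    using fa btwD[OF x(2)] by (intro btwI) (metis insert_iff mem_flip mem_sd)
  ultimately have "sd (sd (flip f x) ?K) a \<subseteq> sd x a \<or> sd x a \<subseteq> sd (sd (flip f x) ?K) a"
    using wedge_chain[OF w] x by blast
  moreover have "k \<in> sd (sd (flip f x) ?K) a \<longleftrightarrow> k \<notin> sd x a" if "k \<in> sd a z" for k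
    using that fa by auto
  ultimately have "(\<forall>k\<in>sd a z. k \<in> sd x a) \<or> (\<forall>k\<in>sd a z. k \<notin> sd x a)"
    by blast
  moreover have "k \<notin> sd x a" if "k \<notin> sd a z" for k
    using btwD[OF x(2), of k] that by auto
  ultimately have "sd x a = sd a z \<or> sd x a = {}"
    by blast
  then show ?thesis
    by (auto simp del: mem_sd simp: sd_def)
qed

text \<open>The invariant of the descent: all lines crossing R also cross the f-edges of R, and R can
  only be left through f-edges or through the vertex p.\<close>

definition descent_state :: "'a set set \<Rightarrow> 'a \<Rightarrow> 'a set \<Rightarrow> bool" where
  "descent_state R f p \<longleftrightarrow> conv V R \<and> p \<in> R \<and> flip f p \<in> V \<and> (\<forall>y\<in>R. (f \<in> y) = (f \<in> p)) \<and>
     (\<forall>y\<in>R. \<forall>e. flip e y \<in> V \<longrightarrow> flip e y \<in> R \<or> e = f \<or> y = p) \<and>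
     (\<forall>k. crosses k R \<longrightarrow> crosses k {y \<in> R. flip f y \<in> V}) \<and> (\<exists>q\<in>R. q \<noteq> p)"

text \<open>The leaf \<open>a\<close> is chosen away from \<open>p\<close>, and \<open>z\<close>
  nearest to it among the \<open>f\<close>-edges, so that no third \<open>f\<close>-edge lies
  between them. The last condition says that all other \<open>f\<close>-edges lie behind
  \<open>z\<close>: the class separating the leaf from the rest belongs to the cell and keeps their
  gates away from \<open>a\<close>.\<close>

lemma descent_wedge:
  assumes st: "descent_state R f p"
  obtains a z where "wedge V a z f" "a \<in> R" "z \<in> R" "a \<noteq> p"
    "\<And>w. w \<in> R \<Longrightarrow> flip f w \<in> V \<Longrightarrow> w \<noteq> a \<Longrightarrow> w \<inter> insert f (sd a z) = z \<inter> insert f (sd a z)"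
proof -
  define W where "W = {y \<in> R. flip f y \<in> V}"
  have R: "conv V R" "p \<in> R" "flip f p \<in> V" and side: "\<And>y. y \<in> R \<Longrightarrow> (f \<in> y) = (f \<in> p)"
    and cr: "\<And>k. crosses k R \<Longrightarrow> crosses k W"
    using st unfolding descent_state_def W_def by blast+
  have RV: "R \<subseteq> V"
    by (rule conv_subset[OF R(1)])
  have pW: "p \<in> W"
    using R by (simp add: W_def)
  obtain q where q: "q \<in> R" "q \<noteq> p"
    using st unfolding descent_state_def by blast
  then obtain k where "(k \<in> q) \<noteq> (k \<in> p)"
    by blast
  then have "crosses k W"
    using cr crossesI q R by metis
  then obtain q' where q': "q' \<in> W" "q' \<noteq> p"
    using crossesD[of k W "k \<notin> p"] by blast
  have "W \<subseteq> {y \<in> V. flip f y \<in> V \<and> (f \<in> y) = (f \<in> p)}"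
    using RV side unfolding W_def by blast
  then have "\<not> shatters2 W g h" if "g \<noteq> h" for g h
    using edge_side_rank1[OF _ that] by blast
  moreover have "finite W"
    using RV finite_V unfolding W_def by (auto intro: finite_subset)
  ultimately have "\<exists>a\<in>W. a \<noteq> p \<and> (\<exists>g. \<forall>w\<in>W. w \<noteq> a \<longrightarrow> (g \<in> w) \<noteq> (g \<in> a))"
    by (intro leaf_exists[OF _ pW q'])
  then obtain a g where a: "a \<in> W" "a \<noteq> p"
    and g: "\<And>w. w \<in> W \<Longrightarrow> w \<noteq> a \<Longrightarrow> (g \<in> w) \<noteq> (g \<in> a)"
    by (elim bexE conjE exE) blast
  obtain z where z: "z \<in> W" "z \<noteq> a"
    and minz: "\<And>w. w \<in> W \<Longrightarrow> w \<noteq> a \<Longrightarrow> card (sd a z) \<le> card (sd a w)"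
    using ex_has_least_nat[of "\<lambda>w. w \<in> W \<and> w \<noteq> a" p "\<lambda>w. card (sd a w)"] pW a by auto
  have mem: "a \<in> R" "z \<in> R" "a \<in> V" "z \<in> V" "flip f a \<in> V" "flip f z \<in> V"
    using a z RV by (auto simp: W_def)
  have fa: "(f \<in> a) = (f \<in> z)"
    using side mem by blast
  have only: "w = a \<or> w = z" if w: "w \<in> V" "btw a w z" "flip f w \<in> V" for w
  proof (rule ccontr)
    assume neq: "\<not> ?thesis"
    have "w \<in> W"
      using convD[OF R(1) mem(1,2) w(1,2)] w by (simp add: W_def)
    then have "card (sd a z) \<le> card (sd a w)"
      using neq minz by blast
    moreover have "sd a w \<subseteq> sd a z"
      using btwD[OF w(2)] by (metis mem_sd subsetI)
    ultimately have "sd a w = sd a z"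
      using card_subset_eq[of "sd a z" "sd a w"] finite_elem mem
      by (metis card_mono finite_sd le_antisym)
    then have "w = z"
      by (auto simp: sd_def)
    then show False
      using neq by blast
  qed
  define K where "K = insert f (sd a z)"
  have w: "wedge V a z f"
    using cell_interval[OF iso_V finite_elem mem(3-6) fa only] mem fa z
    by (auto simp: wedge_def)
  have "w \<inter> K = z \<inter> K" if ww: "w \<in> R" "flip f w \<in> V" "w \<noteq> a" for w
  proof -
    have wW: "w \<in> W"
      using ww by (simp add: W_def)
    have fw: "(f \<in> w) = (f \<in> a)"
      using side ww mem by blast
    \<comment> \<open>Projecting both ends of the \<open>f\<close>-edge at \<open>w\<close> gives an
      \<open>f\<close>-edge of the cell, which can only be the one at \<open>a\<close> or at
      \<open>z\<close>.\<close>
    have "proj a K w \<in> V" "flip f (proj a K w) \<in> V"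
      using wedge_proj[OF w _ K_def, of w] wedge_proj[OF w _ K_def, of "flip f w"] ww RV
        proj_flip[of f K a w] by (auto simp: K_def)
    then have "proj a K w = a \<or> proj a K w = z"
      using only wedge_proj_btw[OF w fw K_def] by blast
    moreover have "g \<in> K" "(g \<in> w) \<noteq> (g \<in> a)"
      using g[of z] g[of w] z wW ww by (auto simp: K_def)
    then have "proj a K w \<noteq> a"
      by (metis mem_proj)
    ultimately have "proj a K w = z"
      by blast
    then show ?thesis
      by (metis Int_eqI mem_proj)
  qed
  then show ?thesis
    using that[OF w mem(1,2) a(2)] unfolding K_def by blast
qed

text \<open>The new region consists of the vertices whose gate is the first bad arc vertex
  \<open>x\<close>; its class \<open>h\<close> is that of the next edge towards \<open>z\<close>.
  Arc vertices before \<open>x\<close> have nothing behind them, so \<open>x\<close> is the only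
  vertex of the region from which an edge can lead back.\<close>

lemma descent_step:
  assumes st: "descent_state R f p"
  shows "(\<exists>a z f. free_wedge V a z f) \<or> (\<exists>R' h x. descent_state R' h x \<and> R' \<subset> R)"
proof -
  obtain a z where w: "wedge V a z f" and aR: "a \<in> R" and zR: "z \<in> R" and ap: "a \<noteq> p"
    and leaf: "\<And>w. w \<in> R \<Longrightarrow> flip f w \<in> V \<Longrightarrow> w \<noteq> a \<Longrightarrow> w \<inter> insert f (sd a z) = z \<inter> insert f (sd a z)"
    using descent_wedge[OF st] by metis
  define K where "K = insert f (sd a z)"
  have R: "conv V R" "p \<in> R" "flip f p \<in> V" and side: "\<And>y. y \<in> R \<Longrightarrow> (f \<in> y) = (f \<in> p)"
    and leave: "\<And>y e. y \<in> R \<Longrightarrow> flip e y \<in> V \<Longrightarrow> flip e y \<in> R \<or> e = f \<or> y = p"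
    and cr: "\<And>k. crosses k R \<Longrightarrow> crosses k {y \<in> R. flip f y \<in> V}"
    using st unfolding descent_state_def by blast+
  have RV: "R \<subseteq> V"
    by (rule conv_subset[OF R(1)])
  have az: "a \<in> V" "z \<in> V" "flip f a \<in> V" "flip f z \<in> V" "(f \<in> a) = (f \<in> z)" "a \<noteq> z"
    using w by (auto simp: wedge_def)
  define B where "B = {x \<in> arc V a z. \<exists>y\<in>V. y \<inter> K = x \<inter> K \<and> y \<noteq> x}"
  show ?thesis
  proof (cases "B = {}")
    case True
    then have "free_wedge V a z f"
      using w unfolding free_wedge_def B_def K_def by blast
    then show ?thesis
      by blast
  next
    case False
    then obtain x0 where "x0 \<in> B"
      by blast
    then obtain x where xB: "x \<in> B" and minx: "\<And>y. y \<in> B \<Longrightarrow> card (sd a x) \<le> card (sd a y)"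
      using ex_has_least_nat[of "\<lambda>w. w \<in> B" x0 "\<lambda>w. card (sd a w)"] by blast
    have x: "x \<in> V" "btw a x z" "x \<noteq> z"
      using xB by (auto simp: B_def arc_def)
    obtain y0 where y0: "y0 \<in> V" "y0 \<inter> K = x \<inter> K" "y0 \<noteq> x"
      using xB by (auto simp: B_def)
    have xK: "x - K = a - K"
      using btw_Diff[OF x(2)] unfolding K_def by blast
    have zK: "z - K = a - K"
      by (auto simp: K_def)
    have xzK: "x \<inter> K \<noteq> z \<inter> K"
      using xK zK x(3) by blast
    have xR: "x \<in> R"
      using convD[OF R(1) aR zR x(1,2)] .
    obtain h where h: "h \<in> sd x z" "flip h x \<in> V"
      using isoD[OF iso_V x(1) az(2) x(3)] by blast
    have hK: "h \<in> sd a z" "(h \<in> x) = (h \<in> a)" "h \<noteq> f"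
      using h btwD[OF x(2), of h] btwD[OF x(2), of f] az(5) by auto
    have hx: "btw a (flip h x) z"
      using btw_btw[of a x z z "flip h x"] btw_flip[OF h(1)] x(2) by simp
    define R' where "R' = {y \<in> V. y \<inter> K = x \<inter> K}"
    have convR': "conv V R'"
      unfolding R'_def by (rule conv_Int[OF conv_refl])
    have xR': "x \<in> R'"
      using x by (simp add: R'_def)
    have R'K: "(k \<in> y) = (k \<in> x)" if "y \<in> R'" "k \<in> K" for y k
      using that unfolding R'_def by blast
    have projR': "proj a K y = x" if "y \<in> R'" for y
      using that proj_eq[OF _ xK] by (simp add: R'_def)
    \<comment> \<open>A step of the region that leaves \<open>R\<close> uses a class outside the
      cell, hence not \<open>f\<close>, so it starts at \<open>p\<close>. But \<open>p\<close> has
      gate \<open>z\<close>, not \<open>x\<close>.\<close>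
    have R'R: "R' \<subseteq> R"
    proof
      fix y assume y: "y \<in> R'"
      show "y \<in> R"
      proof (rule ccontr)
        assume "y \<notin> R"
        then obtain u e where u: "u \<in> R'" "u \<in> R" "flip e u \<in> R'" "flip e u \<notin> R"
          using iso_exit[OF iso_conv[OF convR'] _ xR' y, of "\<lambda>u. u \<in> R"] xR finite_elem x y
          by (auto simp: R'_def)
        have "e \<notin> K"
          using R'K[OF u(1), of e] R'K[OF u(3), of e] by auto
        moreover have "flip e u \<in> V"
          using u(3) by (simp add: R'_def)
        ultimately have "u = p"
          using leave[OF u(2), of e] u(4) by (auto simp: K_def)
        then have "u \<inter> K = z \<inter> K"
          using leaf[of p] R ap by (auto simp: K_def)
        then show False
          using u(1) xzK by (simp add: R'_def)
      qed
    qed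
    \<comment> \<open>An edge leaving the region flips some \<open>e\<close> in \<open>K\<close> and
      projects to the edge between \<open>x\<close> and \<open>flip e x\<close>. This edge crosses
      \<open>f\<close>, goes forward to \<open>z\<close>, or goes back to \<open>a\<close>.\<close>
    have leave': "flip e y \<in> R' \<or> e = h \<or> y = x" if y: "y \<in> R'" "flip e y \<in> V" for y e
    proof (cases "e \<in> K")
      case False
      then have "flip e y \<inter> K = y \<inter> K"
        by auto
      then show ?thesis
        using y by (simp add: R'_def)
    next
      case True
      have ex: "flip e x \<in> V"
        using wedge_proj[OF w y(2) K_def] proj_flip[OF True, of a y] projR'[OF y(1)] by simp
      show ?thesis
      proof (cases "e = f")
        case True
        then have "x = a"
          using wedge_ends[OF w x(1,2)] ex x(3) by blast
        moreover have "y = a"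
          using leaf[of y] y True R'R xzK by (auto simp: R'_def K_def)
        ultimately show ?thesis
          by simp
      next
        case False
        then have e: "e \<in> sd a z"
          using True by (simp add: K_def)
        then have eb: "btw a (flip e x) z"
          using btwD[OF x(2)] by (intro btwI) (metis mem_flip mem_sd)
        show ?thesis
        proof (cases "(e \<in> x) = (e \<in> a)")
          case eq: True
          have "e = h"
          proof (rule ccontr)
            assume "e \<noteq> h"
            \<comment> \<open>Two different forward edges at \<open>x\<close> would branch the
              path.\<close>
            have "shatters2 {t \<in> V. btw a t z} e h"
              by (rule shatters2I[where b = "e \<in> a" and c = "h \<in> a" and ?x1.0 = a
                    and ?x2.0 = "flip h x" and ?x3.0 = "flip e x" and ?x4.0 = z])
                (use az eb hx ex h hK e eq \<open>e \<noteq> h\<close> in auto)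
            then show False
              using wedge_not_shatters2[OF w e hK(1) \<open>e \<noteq> h\<close>] by blast
          qed
          then show ?thesis
            by simp
        next
          case neq: False
          \<comment> \<open>Going back reaches an arc vertex before \<open>x\<close>. It is not bad,
            so \<open>flip e y\<close>, having the same trace, must coincide with it.\<close>
          have "flip e x \<noteq> z"
            using neq e by (metis mem_flip mem_sd)
          then have "flip e x \<in> arc V a z"
            using ex eb by (simp add: arc_def)
          moreover have "card (sd (flip e x) a) < card (sd x a)"
            using card_sd_flip[of x a e] neq finite_elem x az by auto
          then have "card (sd a (flip e x)) < card (sd a x)"
            by (simp add: sd_def Un_commute)
          then have "flip e x \<notin> B"
            using minx by (meson not_le)
          moreover have "flip e y \<inter> K = flip e x \<inter> K"
            using R'K[OF y(1)] by auto
          ultimately have "flip e y = flip e x"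
            using y(2) unfolding B_def by blast
          then have "y = x"
            by (metis flip_flip)
          then show ?thesis
            by simp
        qed
      qed
    qed
    have cross': "crosses k {y \<in> R'. flip h y \<in> V}" if k: "crosses k R'" for k
    proof -
      have kK: "k \<notin> K"
        using k R'K unfolding crosses_def by blast
      have "crosses k R"
        using k R'R unfolding crosses_def by blast
      \<comment> \<open>\<open>v\<close> supplies the value of \<open>k\<close> that
        \<open>z\<close> lacks. As \<open>a\<close> and \<open>z\<close> agree outside the cell,
        \<open>v\<close> is not \<open>a\<close>, so it lies behind \<open>z\<close>.\<close>
      then obtain v where v: "v \<in> R" "flip f v \<in> V" "(k \<in> v) \<noteq> (k \<in> z)"
        using crossesD[OF cr, of k "k \<notin> z"] by auto
      have "v \<noteq> a"
        using v kK by (auto simp: K_def)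
      then have vK: "v \<inter> K = z \<inter> K"
        using leaf v unfolding K_def by blast
      \<comment> \<open>Inside \<open>R\<close>, a vertex of the region and \<open>t\<close> can be
        chosen with the same value at \<open>k\<close>, and \<open>h\<close> separates them. This
        yields an \<open>h\<close>-edge with that value; it projects to an \<open>h\<close>-edge of
        the path, which crosses \<open>h\<close> only at \<open>x\<close>.\<close>
      have main: "\<exists>u\<in>{y \<in> R'. flip h y \<in> V}. (k \<in> u) = (k \<in> t)" if t: "t \<in> R" "t \<inter> K = z \<inter> K" for t
      proof -
        obtain y1 where y1: "y1 \<in> R'" "(k \<in> y1) = (k \<in> t)"
          using crossesD[OF k] by blast
        let ?S = "{s \<in> R. (k \<in> s) = (k \<in> t)}"
        have hKK: "h \<in> K"
          using hK by (simp add: K_def)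
        have "(h \<in> y1) \<noteq> (h \<in> t)"
          using R'K[OF y1(1) hKK] Int_eqD[OF t(2) hKK] h by auto
        then obtain u where u: "u \<in> ?S" "(h \<in> u) = (h \<in> y1)" "flip h u \<in> ?S"
          using iso_edge[OF iso_conv[OF conv_halfspace[OF R(1)]], of y1 t k "k \<in> t" h]
            finite_sd[OF finite_elem finite_elem, of y1 t] y1 t subsetD[OF R'R] subsetD[OF RV]
          by auto
        define s where "s = proj a K u"
        have uV: "u \<in> V" "flip h u \<in> V" "u \<in> R" "flip h u \<in> R"
          using u RV by auto
        have s: "s \<in> V" "flip h s \<in> V"
          using wedge_proj[OF w _ K_def] uV proj_flip[OF hKK, of a u] by (metis s_def)+
        have sb: "btw a s z" "btw a (flip h s) z"
          using wedge_proj_btw[OF w _ K_def] uV side[of u] side[of "flip h u"] side[of a] aR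
            proj_flip[OF hKK, of a u] by (metis s_def)+
        have hs: "(h \<in> s) = (h \<in> x)"
          using hKK u(2) R'K[OF y1(1) hKK] by (simp add: s_def)
        have "s = x"
        proof (rule ccontr)
          assume "s \<noteq> x"
          then obtain l where l: "(l \<in> s) \<noteq> (l \<in> x)"
            by blast
          then have "l \<noteq> h" "l \<in> sd a z"
            using hs btwD[OF sb(1), of l] btwD[OF x(2), of l] by auto
          have "shatters2 {t \<in> V. btw a t z} l h"
            by (rule shatters2I[where b = "l \<in> x" and c = "h \<in> x" and ?x1.0 = x
                  and ?x2.0 = "flip h x" and ?x3.0 = s and ?x4.0 = "flip h s"])
              (use s sb x h hx l hs \<open>l \<noteq> h\<close> in auto)
          then show False
            using wedge_not_shatters2[OF w \<open>l \<in> sd a z\<close> hK(1) \<open>l \<noteq> h\<close>] by blast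
        qed
        then have "u \<inter> K = x \<inter> K"
          unfolding s_def by (metis Int_eqI mem_proj)
        then show ?thesis
          using uV u by (auto simp: R'_def)
      qed
      show ?thesis
        using main[OF zR refl] main[OF v(1) vK] v(3) unfolding crosses_def by blast
    qed
    have "descent_state R' h x"
      unfolding descent_state_def
    proof (intro conjI ballI allI impI)
      show "(h \<in> y) = (h \<in> x)" if "y \<in> R'" for y
        using R'K[OF that] hK(1) by (simp add: K_def)
      show "\<exists>q\<in>R'. q \<noteq> x"
        using y0 unfolding R'_def by blast
    qed (use convR' xR' h(2) leave' cross' in blast)+
    moreover have "z \<notin> R'"
      using xzK by (auto simp: R'_def)
    then have "R' \<subset> R"
      using zR R'R by blast
    ultimately show ?thesis
      by blast
  qed
qed

lemma free_wedge_from_descent: "descent_state R f p \<Longrightarrow> \<exists>a z f. free_wedge V a z f"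
proof (induction "card R" arbitrary: R f p rule: less_induct)
  case less
  then have "conv V R"
    by (simp add: descent_state_def)
  then have "finite R"
    using conv_subset finite_V finite_subset by metis
  then show ?case
    using descent_step[OF less.prems] less.hyps psubset_card_mono by metis
qed

text \<open>A smallest halfspace \<open>R\<close> is the first region. If \<open>k\<close> crosses
  \<open>R\<close> but misses a value on the other side of \<open>f\<close>, the vertices with that
  value form a halfspace properly inside \<open>R\<close>. So each value of \<open>k\<close> occurs
  on both sides of \<open>f\<close>, and each halfspace of \<open>k\<close> contains an
  \<open>f\<close>-edge.\<close>

lemma corner_exists:
  assumes "x0 \<in> V"
  shows "V = {x0} \<or> (\<exists>p f. pendant V p f) \<or> (\<exists>a z f. free_wedge V a z f)"
proof (cases "V = {x0}")
  case False
  define H where "H kb = {y \<in> V. (fst kb \<in> y) = snd kb}" for kb :: "'a \<times> bool"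
  \<comment> \<open>Restricts the minimum to signed classes that are not constant on
    \<open>V\<close>.\<close>
  let ?Q = "\<lambda>kb. H kb \<noteq> {} \<and> H (fst kb, \<not> snd kb) \<noteq> {}"
  obtain y0 where y0: "y0 \<in> V" "y0 \<noteq> x0"
    using False assms by blast
  then obtain k0 where "(k0 \<in> y0) \<noteq> (k0 \<in> x0)"
    by blast
  then have "?Q (k0, k0 \<in> x0)"
    using y0 assms by (auto simp: H_def)
  then obtain kb where kb: "?Q kb" and minkb: "\<And>kb'. ?Q kb' \<Longrightarrow> card (H kb) \<le> card (H kb')"
    using ex_has_least_nat[of ?Q _ "\<lambda>kb. card (H kb)"] by blast
  obtain f b where fb: "kb = (f, b)"
    by (cases kb)
  define R where "R = H (f, b)"
  have mR: "y \<in> R \<longleftrightarrow> y \<in> V \<and> (f \<in> y) = b" for y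
    by (auto simp: R_def H_def)
  have convR: "conv V R"
    unfolding R_def H_def using conv_halfspace[OF conv_refl, of V f b] by simp
  obtain s t where st: "s \<in> R" "t \<in> V" "(f \<in> t) \<noteq> b"
    using kb fb by (auto simp: R_def H_def)
  obtain p where p: "p \<in> R" "flip f p \<in> V"
    using iso_edge[OF iso_V, of s t f] st finite_elem mR by auto
  show ?thesis
  proof (cases "R = {p}")
    case True
    have "e = f" if "flip e p \<in> V" for e
    proof (rule ccontr)
      assume "e \<noteq> f"
      then have "(f \<in> flip e p) = (f \<in> p)"
        by simp
      then have "flip e p \<in> R"
        using that p mR by blast
      then show False
        using True flip_neq(1)[of e p] by blast
    qed
    then have "pendant V p f"
      using p mR unfolding pendant_def by blast
    then show ?thesis
      by blast
  next
    case False
    have "crosses k {y \<in> R. flip f y \<in> V}" if k: "crosses k R" for k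
    proof -
      have opp: "\<exists>t\<in>V. (f \<in> t) \<noteq> b \<and> (k \<in> t) = c" for c
      proof (rule ccontr)
        assume no: "\<not> ?thesis"
        obtain y1 y2 where y: "y1 \<in> R" "(k \<in> y1) = c" "y2 \<in> R" "(k \<in> y2) = (\<not> c)"
          using crossesD[OF k] by metis
        have "H (k, c) \<subset> R"
          using no y mR unfolding H_def fst_conv snd_conv by blast
        moreover have "?Q (k, c)"
          using y mR by (auto simp: H_def)
        then have "card R \<le> card (H (k, c))"
          using minkb[of "(k, c)"] fb by (simp add: R_def)
        moreover have "finite R"
          using finite_V conv_subset[OF convR] finite_subset by blast
        ultimately show False
          using psubset_card_mono[of R "H (k, c)"] by linarith
      qed
      have "\<exists>u\<in>{y \<in> R. flip f y \<in> V}. (k \<in> u) = c" for c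
      proof -
        obtain t' where t': "t' \<in> V" "(f \<in> t') \<noteq> b" "(k \<in> t') = c"
          using opp by blast
        obtain y where y: "y \<in> R" "(k \<in> y) = c"
          using crossesD[OF k] by blast
        let ?S = "{s \<in> V. (k \<in> s) = c}"
        have mem: "y \<in> V" "y \<in> ?S" "t' \<in> ?S" "(f \<in> y) = b"
          using y t' mR by blast+
        then obtain u where "u \<in> ?S" "(f \<in> u) = (f \<in> y)" "flip f u \<in> ?S"
          using iso_edge[OF iso_conv[OF conv_halfspace[OF conv_refl]] _ mem(2,3), of f] t'(1,2)
            finite_sd[OF finite_elem finite_elem, of y t'] by blast
        then show ?thesis
          using mem mR by blast
      qed
      from this[of True] this[of False] show ?thesis
        unfolding crosses_def by blast
    qed
    moreover have "flip e y \<in> R \<or> e = f" if y: "y \<in> R" "flip e y \<in> V" for e y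
    proof -
      have "flip e y \<in> R" if "e \<noteq> f"
      proof -
        have "(f \<in> flip e y) = (f \<in> y)"
          using that by simp
        then show ?thesis
          using y mR by metis
      qed
      then show ?thesis
        by blast
    qed
    moreover have "(f \<in> y) = (f \<in> p)" if "y \<in> R" for y
      using that p(1) mR by blast
    moreover have "\<exists>q\<in>R. q \<noteq> p"
      using False p(1) by blast
    ultimately have "descent_state R f p"
      unfolding descent_state_def using convR p by (intro conjI ballI allI impI) blast+
    then show ?thesis
      using free_wedge_from_descent by blast
  qed
qed simp

end

subsection \<open>Removing a corner\<close>

context com2
begin

text \<open>When no removed vertex lies in the fibre of a cell of \<open>V - C\<close>, this cell is
  also one of \<open>V\<close>. Its gates then exist in \<open>V\<close> and, lying in the fibre,
  are not removed.\<close>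

lemma com2_remove:
  assumes iso: "iso (V - C)"
    and fibre: "\<And>x K c. cell (V - C) x K \<Longrightarrow> c \<in> C \<Longrightarrow> c \<in> V \<Longrightarrow> c - K \<noteq> x - K"
  shows "com2 (V - C)"
proof
  show "finite (V - C)"
    using finite_V by simp
  show "finite x" if "x \<in> V - C" for x
    using that finite_elem by blast
  show "iso (V - C)" by fact
  show "proj x K z \<in> V - C" if c: "cell (V - C) x K" and z: "z \<in> V - C" for x K z
  proof -
    have "sd y K \<in> V" if y: "y \<in> V" "y - K = x - K" for y
    proof -
      have "y \<notin> C"
        using fibre[OF c] y by blast
      then show ?thesis
        using c y unfolding cell_def by blast
    qed
    then have "cell V x K"
      using c unfolding cell_def by blast
    then have "proj x K z \<in> V"
      using gate z by blast
    moreover have "proj x K z - K = x - K"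
      by (auto simp: proj_def)
    ultimately show ?thesis
      using fibre[OF c] by blast
  qed
  show "\<not> shatters3 (V - C) f g h" if "f \<noteq> g" "f \<noteq> h" "g \<noteq> h" for f g h
    using rank2[OF that] unfolding shatters3_def by blast
qed

lemma pendant_separated:
  assumes "pendant V p f" "y \<in> V" "y \<noteq> p"
  shows "(f \<in> y) \<noteq> (f \<in> p)"
proof -
  obtain e where "e \<in> sd p y" "flip e p \<in> V"
    using isoD[OF iso_V, of p y] assms unfolding pendant_def by blast
  then show ?thesis
    using assms(1) unfolding pendant_def by auto
qed

text \<open>The class \<open>f\<close> separates \<open>p\<close> from all other vertices. So no
  shortest step between them enters \<open>p\<close>, and a remaining cell with \<open>p\<close> in
  its fibre would contain the class \<open>f\<close>, which is now constant.\<close>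

lemma pendant_remove:
  assumes p: "pendant V p f"
  shows "com2 (V - {p})"
proof (rule com2_remove)
  show "iso (V - {p})"
    unfolding iso_def
  proof (intro ballI impI)
    fix x y assume xy: "x \<in> V - {p}" "y \<in> V - {p}" "x \<noteq> y"
    then obtain e where e: "e \<in> sd x y" "flip e x \<in> V"
      using isoD[OF iso_V, of x y] by blast
    have "flip e x \<noteq> p"
    proof
      assume "flip e x = p"
      then have "flip e p = x"
        by (metis flip_flip)
      then have "e = f"
        using p xy unfolding pendant_def by blast
      moreover have "(f \<in> x) = (f \<in> y)"
        using pendant_separated[OF p, of x] pendant_separated[OF p, of y] xy by blast
      ultimately show False
        using e by simp
    qed
    then show "\<exists>e\<in>sd x y. flip e x \<in> V - {p}"
      using e by blast
  qed
  show "c - K \<noteq> x - K" if c: "cell (V - {p}) x K" "c \<in> {p}" for x K c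
  proof
    assume "c - K = x - K"
    then have pK: "p - K = x - K"
      using c by simp
    have x: "x \<in> V" "x \<noteq> p" "sd x K \<in> V" "sd x K \<noteq> p"
      using c unfolding cell_def by blast+
    have "f \<in> K"
      using pendant_separated[OF p x(1,2)] pK by blast
    then show False
      using pendant_separated[OF p x(1,2)] pendant_separated[OF p x(3,4)] by simp
  qed
qed

text \<open>A gate on the arc would place \<open>y\<close> behind a free vertex.\<close>

lemma free_wedge_proj:
  assumes w: "free_wedge V a z f" and y: "y \<in> V" "y \<notin> arc V a z" and K: "K = insert f (sd a z)"
  shows "proj a K y = z \<or> (f \<in> y) \<noteq> (f \<in> a)"
proof (rule ccontr)
  assume no: "\<not> ?thesis"
  have w': "wedge V a z f"
    using w by (simp add: free_wedge_def)
  have "proj a K y \<in> arc V a z"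
    using wedge_proj[OF w' y(1) K] wedge_proj_btw[OF w' _ K] no by (simp add: arc_def)
  moreover have "y \<inter> K = proj a K y \<inter> K"
    by (auto simp: proj_def)
  ultimately have "y = proj a K y"
    using w y unfolding free_wedge_def K by blast
  then show False
    using y \<open>proj a K y \<in> arc V a z\<close> by simp
qed

text \<open>A step into the arc starts at \<open>z\<close>, or at \<open>flip f a\<close> through
  \<open>f\<close>. The rest of the cycle offers a replacement towards \<open>y\<close>: crossing
  \<open>f\<close> at \<open>z\<close> in the first case, moving towards \<open>flip f z\<close> in
  the second.\<close>

lemma free_wedge_remove_iso:
  assumes w: "free_wedge V a z f"
  shows "iso (V - arc V a z)"
  unfolding iso_def
proof (intro ballI impI)
  define K where "K = insert f (sd a z)"
  have w': "wedge V a z f"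
    and triv: "\<And>x y. x \<in> arc V a z \<Longrightarrow> y \<in> V \<Longrightarrow> y \<inter> K = x \<inter> K \<Longrightarrow> y = x"
    using w unfolding free_wedge_def K_def by blast+
  have az: "a \<in> V" "z \<in> V" "flip f a \<in> V" "flip f z \<in> V" "(f \<in> a) = (f \<in> z)" "a \<noteq> z"
    using w' by (auto simp: wedge_def)
  have arcf: "(f \<in> c) = (f \<in> a)" if "c \<in> arc V a z" for c
    using that btwD[of a c z f] az(5) unfolding arc_def by blast
  fix x y assume x: "x \<in> V - arc V a z" and y: "y \<in> V - arc V a z" and xy: "x \<noteq> y"
  then obtain e where e: "e \<in> sd x y" "flip e x \<in> V"
    using isoD[OF iso_V, of x y] by blast
  show "\<exists>e\<in>sd x y. flip e x \<in> V - arc V a z"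
  proof (cases "flip e x \<in> arc V a z")
    case False
    then show ?thesis
      using e by blast
  next
    case True
    have eK: "e \<in> K"
    proof (rule ccontr)
      assume "e \<notin> K"
      then have "x \<inter> K = flip e x \<inter> K"
        by auto
      then show False
        using triv[OF True, of x] x True by auto
    qed
    have exK: "x - K = a - K"
    proof -
      have "flip e x - K = a - K"
        using True btw_Diff[of a "flip e x" z K] unfolding arc_def K_def by blast
      moreover have "x - K = flip e x - K"
        using eK by auto
      ultimately show ?thesis
        by simp
    qed
    have xproj: "proj a K x = x"
      using proj_eq[OF refl exK] .
    show ?thesis
    proof (cases "x = z")
      case True
      have "(f \<in> y) \<noteq> (f \<in> a)"
      proof (rule ccontr)
        assume "\<not> ?thesis"
        then have "proj a K y = z"
          using free_wedge_proj[OF w _ _ K_def, of y] y by blast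
        then have "(e \<in> y) = (e \<in> z)"
          using eK by (metis mem_proj)
        then show False
          using e True by simp
      qed
      moreover have "flip f z \<notin> arc V a z"
        using arcf[of "flip f z"] az(5) by auto
      ultimately show ?thesis
        using True az by (intro bexI[of _ f]) auto
    next
      case False
      then have fx: "(f \<in> x) \<noteq> (f \<in> a)"
        using free_wedge_proj[OF w _ _ K_def, of x] x xproj by auto
      have ef: "e = f"
        using arcf[OF True] fx by auto
      then have "flip f x = a"
        using wedge_ends[OF w', of "flip f x"] True x unfolding arc_def by auto
      then have xb: "x = flip f a"
        by (metis flip_flip)
      have "(f \<in> y) = (f \<in> a)"
        using e ef fx by auto
      then have "proj a K y = z"
        using free_wedge_proj[OF w _ _ K_def, of y] y by blast
      then have yK: "(k \<in> y) = (k \<in> z)" if "k \<in> K" for k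
        using that by (metis mem_proj)
      have "flip f a \<noteq> flip f z"
        using az(6) by (metis flip_flip)
      then obtain e' where e': "e' \<in> sd (flip f a) (flip f z)" "flip e' (flip f a) \<in> V"
        using isoD[OF iso_V az(3,4)] by blast
      then have "e' \<in> sd a z" "e' \<noteq> f"
        using az(5) by auto
      then have "e' \<in> sd x y"
        using yK[of e'] xb by (auto simp: K_def)
      moreover have "flip e' x \<notin> arc V a z"
        using arcf[of "flip e' x"] \<open>e' \<noteq> f\<close> fx by auto
      ultimately show ?thesis
        using e' xb by blast
    qed
  qed
qed

text \<open>Suppose that a remaining cell with classes \<open>J\<close> has the arc vertex
  \<open>c\<close> in its fibre. If \<open>K \<subseteq> J\<close>, the \<open>K\<close>-antipode of
  \<open>c\<close> followed by its \<open>J\<close>-antipode gives a vertex outside the arc with the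
  trace of \<open>c\<close>. Otherwise consider \<open>x\<close> and its \<open>J\<close>-antipode.
  If both lie across \<open>f\<close>, so does \<open>c\<close>; if one of them has gate
  \<open>z\<close>, the chain condition forces \<open>c = z\<close>.\<close>

lemma free_wedge_remove:
  assumes w: "free_wedge V a z f"
  shows "com2 (V - arc V a z)"
proof (rule com2_remove[OF free_wedge_remove_iso[OF w]])
  define K where "K = insert f (sd a z)"
  have w': "wedge V a z f"
    and triv: "\<And>x y. x \<in> arc V a z \<Longrightarrow> y \<in> V \<Longrightarrow> y \<inter> K = x \<inter> K \<Longrightarrow> y = x"
    using w unfolding free_wedge_def K_def by blast+
  have az: "a \<in> V" "z \<in> V" "flip f a \<in> V" "flip f z \<in> V" "(f \<in> a) = (f \<in> z)" "a \<noteq> z"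
    using w' by (auto simp: wedge_def)
  fix x J c assume cJ: "cell (V - arc V a z) x J" and c: "c \<in> arc V a z" "c \<in> V"
  have cb: "btw a c z" "c \<noteq> z"
    using c by (auto simp: arc_def)
  have fc: "(f \<in> c) = (f \<in> a)"
    using btwD[OF cb(1), of f] az(5) by blast
  have inC: "False" if "y \<in> V - arc V a z" "y \<inter> K = c \<inter> K" for y
    using triv[OF c(1), of y] that c by blast
  show "c - J \<noteq> x - J"
  proof
    assume cx: "c - J = x - J"
    have cellJ: "sd y J \<in> V - arc V a z" if "y \<in> V - arc V a z" "y - J = x - J" for y
      using cJ that unfolding cell_def by blast
    have x: "x \<in> V - arc V a z"
      using cJ unfolding cell_def by blast
    show False
    proof (cases "K \<subseteq> J")
      case True
      have "sd c K \<in> V"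
        using wedge_opposite[OF w' c(2) cb(1)] by (simp add: K_def)
      moreover have "sd c K \<notin> arc V a z"
      proof
        assume "sd c K \<in> arc V a z"
        then have "(f \<in> sd c K) = (f \<in> a)"
          using btwD[of a "sd c K" z f] az(5) unfolding arc_def by blast
        then show False
          using fc by (simp add: K_def)
      qed
      moreover have "sd c K - J = x - J"
        using cx True by (auto simp: sd_def)
      ultimately have "sd (sd c K) J \<in> V - arc V a z"
        using cellJ by blast
      moreover have "sd (sd c K) J \<inter> K = c \<inter> K"
        using True by (auto simp: sd_def)
      ultimately show False
        using inC by blast
    next
      case False
      define x' where "x' = sd x J"
      have x': "x' \<in> V - arc V a z"
        using cellJ x by (simp add: x'_def)
      have agree: "(k \<in> c) = (k \<in> u)" if "k \<notin> J" "u = x \<or> u = x'" for k u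
        using cx that by (auto simp: x'_def set_eq_iff)
      have differ: "(k \<in> x) \<noteq> (k \<in> x')" if "k \<in> J" for k
        using that by (auto simp: x'_def)
      have main: False
        if uv: "u \<in> V - arc V a z" "v \<in> V - arc V a z" "{u, v} = {x, x'}" "proj a K u = z" for u v
      proof -
        have uv_agree: "(k \<in> c) = (k \<in> u)" "(k \<in> c) = (k \<in> v)" if "k \<notin> J" for k
          using agree[OF that] uv(3) by (auto simp: doubleton_eq_iff)
        have uv_differ: "(k \<in> u) \<noteq> (k \<in> v)" if "k \<in> J" for k
          using differ[OF that] uv(3) by (auto simp: doubleton_eq_iff)
        have uK: "(k \<in> u) = (k \<in> z)" if "k \<in> K" for k
          using that uv(4) by (metis mem_proj)
        \<comment> \<open>The antipode brings the gate of \<open>v\<close> back to the side of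
          \<open>a\<close>, onto the same path as \<open>c\<close>. Within \<open>sd a z\<close>,
          \<open>d\<close> differs from \<open>a\<close> exactly where \<open>v\<close> agrees with
          \<open>a\<close>.\<close>
        define d where "d = sd (proj a K v) K"
        have vV: "proj a K v \<in> V"
          using wedge_proj[OF w' _ K_def] uv(2) by blast
        have fv: "(f \<in> v) \<noteq> (f \<in> a)"
        proof (rule ccontr)
          assume "\<not> ?thesis"
          then have "proj a K v = z"
            using free_wedge_proj[OF w _ _ K_def, of v] uv(2) by blast
          then have "(k \<in> v) = (k \<in> u)" if "k \<in> K" for k
            using that uK by (metis mem_proj)
          then have "k \<notin> J" if "k \<in> K" for k
            using uv_differ that by blast
          then have "u \<inter> K = c \<inter> K"
            using uv_agree by blast
          then show False
            using inC uv(1) by blast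
        qed
        have "proj a K v - K = a - K"
          by (auto simp: proj_def)
        then have "d \<in> V"
          using w' vV unfolding wedge_def cell_def d_def K_def by blast
        moreover have "btw a d z"
          using fv by (intro btwI) (auto simp: d_def K_def)
        ultimately have chain: "sd d a \<subseteq> sd c a \<or> sd c a \<subseteq> sd d a"
          using wedge_chain[OF w' _ _ c(2) cb(1)] by blast
        have dk: "k \<in> sd d a \<longleftrightarrow> (k \<in> v) = (k \<in> a)" if "k \<in> sd a z" for k
          using that by (auto simp: d_def K_def)
        have "f \<in> J"
          using uv_agree[of f] fc fv by blast
        obtain l where l: "l \<in> K" "l \<notin> J"
          using False by blast
        then have lz: "l \<in> sd a z" "(l \<in> c) = (l \<in> z)" "(l \<in> v) = (l \<in> z)"
          using \<open>f \<in> J\<close> uv_agree[OF l(2)] uK[OF l(1)] by (auto simp: K_def)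
        \<comment> \<open>The class \<open>l\<close> outside \<open>J\<close>, where
          \<open>c\<close> and \<open>v\<close> share the value of \<open>z\<close>, decides the
          direction of the comparison.\<close>
        have "\<not> sd c a \<subseteq> sd d a"
        proof
          assume "sd c a \<subseteq> sd d a"
          moreover have "l \<in> sd c a" "l \<notin> sd d a"
            using lz dk[OF lz(1)] by auto
          ultimately show False
            by blast
        qed
        then have sub: "sd d a \<subseteq> sd c a"
          using chain by blast
        have "(k \<in> c) = (k \<in> z)" if k: "k \<in> sd a z" for k
        proof (cases "k \<in> J")
          case True
          then have "(k \<in> v) = (k \<in> a)"
            using uv_differ[OF True] uK[of k] k by (auto simp: K_def)
          then have "k \<in> sd c a"
            using sub dk[OF k] by blast
          then show ?thesis
            using k by auto
        next
          case False
          then show ?thesis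
            using uv_agree[OF False] uK[of k] k by (auto simp: K_def)
        qed
        then have "c = z"
          using btwD[OF cb(1)] by (metis mem_sd set_eqI)
        then show False
          using cb(2) by blast
      qed
      have nx: "(f \<in> x) \<noteq> (f \<in> a)" "(f \<in> x') \<noteq> (f \<in> a)"
        using free_wedge_proj[OF w _ _ K_def, of x] free_wedge_proj[OF w _ _ K_def, of x']
          main[of x x'] main[of x' x] x x' by blast+
      then have "f \<notin> J"
        using differ by blast
      then show False
        using agree[of f x] nx fc by blast
    qed
  qed
qed

end

subsection \<open>Walks, convexity and gates in terms of coordinates\<close>

lemma hdist_sd: "hdist x y = card (sd x y)"
  by (simp add: hdist_def sd_def)

lemma hdist_triangle:
  assumes "finite x" "finite y" "finite z"
  shows "hdist x y \<le> hdist x z + hdist z y"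
proof -
  have "card (sd x y) \<le> card (sd x z \<union> sd z y)"
    using assms by (intro card_mono) (auto simp: sd_def)
  also have "\<dots> \<le> card (sd x z) + card (sd z y)"
    by (rule card_Un_le)
  finally show ?thesis
    by (simp add: hdist_sd)
qed

lemma btw_iff_hdist:
  assumes "finite x" "finite y" "finite z"
  shows "btw x z y \<longleftrightarrow> hdist x y = hdist x z + hdist z y"
proof -
  let ?A = "sd x z" and ?B = "sd z y"
  have fin: "finite ?A" "finite ?B"
    using assms by simp_all
  have "sd x y = (?A \<union> ?B) - (?A \<inter> ?B)"
    by auto
  then have "card (sd x y) = card (?A \<union> ?B) - card (?A \<inter> ?B)"
    using fin by (simp add: card_Diff_subset le_infI1 del: mem_sd)
  moreover have "card (?A \<inter> ?B) \<le> card (?A \<union> ?B)"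
    using fin by (intro card_mono) auto
  ultimately have "card (sd x y) + 2 * card (?A \<inter> ?B) = card ?A + card ?B"
    using card_Un_Int[OF fin] by linarith
  moreover have "btw x z y \<longleftrightarrow> ?A \<inter> ?B = {}"
    by (auto simp: btw_def)
  moreover have "?A \<inter> ?B = {} \<longleftrightarrow> card (?A \<inter> ?B) = 0"
    using fin by simp
  ultimately show ?thesis
    unfolding hdist_sd by linarith
qed

lemma adj_flip: "adj x (flip e x)"
proof -
  have "sd x (flip e x) = {e}"
    by auto
  then show ?thesis
    by (simp add: adj_def hdist_sd)
qed

lemma adjE:
  assumes "adj x y"
  obtains e where "y = flip e x"
proof -
  obtain e where "sd x y = {e}"
    using assms by (auto simp: adj_def hdist_sd card_Suc_eq)
  then have "k \<in> y \<longleftrightarrow> k \<in> flip e x" for k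
    using mem_sd[of k x y] by auto
  then have "y = flip e x"
    by blast
  then show thesis
    using that by blast
qed

lemma walk_singleton: "walk V [u] x y \<longleftrightarrow> u \<in> V \<and> x = u \<and> y = u"
  by (auto simp: walk_def)

lemma walk_Cons:
  "p \<noteq> [] \<Longrightarrow> walk V (u # p) x y \<longleftrightarrow> u \<in> V \<and> x = u \<and> adj u (hd p) \<and> walk V p (hd p) y"
  by (cases p) (auto simp: walk_def)

lemma walk_length:
  assumes "\<And>v. v \<in> V \<Longrightarrow> finite v" "walk V p x y"
  shows "hdist x y < length p"
  using assms(2)
proof (induction p arbitrary: x)
  case Nil
  then show ?case
    by (simp add: walk_def)
next
  case (Cons u p)
  show ?case
  proof (cases "p = []")
    case True
    then show ?thesis
      using Cons.prems by (auto simp: walk_singleton hdist_def)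
  next
    case False
    then have w: "walk V p (hd p) y" "adj x (hd p)" "x \<in> V"
      using Cons.prems walk_Cons by metis+
    have mem: "hd p \<in> V" "y \<in> V"
      using w(1) by (auto simp: walk_def)
    have "hdist x y \<le> hdist x (hd p) + hdist (hd p) y"
      using hdist_triangle assms(1) w mem by blast
    then show ?thesis
      using Cons.IH[OF w(1)] w(2) by (simp add: adj_def)
  qed
qed

lemma walk_exists:
  assumes "iso V" "\<And>v. v \<in> V \<Longrightarrow> finite v" "x \<in> V" "y \<in> V"
  shows "\<exists>p. walk V p x y \<and> length p = Suc (hdist x y)"
  using assms(3)
proof (induction "hdist x y" arbitrary: x rule: less_induct)
  case less
  show ?case
  proof (cases "x = y")
    case True
    then show ?thesis
      using less.prems by (intro exI[of _ "[x]"]) (simp add: walk_singleton hdist_def)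
  next
    case False
    then obtain e where e: "e \<in> sd x y" "flip e x \<in> V"
      using isoD[OF assms(1) less.prems assms(4)] by blast
    have h: "hdist x y = Suc (hdist (flip e x) y)"
      using card_sd_flip(2)[OF _ e(1)] assms(2) less.prems assms(4) by (simp add: hdist_sd)
    then obtain p where p: "walk V p (flip e x) y" "length p = Suc (hdist (flip e x) y)"
      using less.hyps[of "flip e x"] e by auto
    then have "p \<noteq> []" "hd p = flip e x"
      by (auto simp: walk_def)
    then have "walk V (x # p) x y"
      using p less.prems adj_flip by (simp add: walk_Cons)
    then show ?thesis
      using p h by (intro exI[of _ "x # p"]) simp
  qed
qed

lemma gdist_eq_hdist:
  assumes "iso V" "\<And>v. v \<in> V \<Longrightarrow> finite v" "x \<in> V" "y \<in> V"
  shows "gdist V x y = hdist x y"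
  unfolding gdist_def
proof (rule Least_equality)
  show "\<exists>p. walk V p x y \<and> length p = Suc (hdist x y)"
    by (rule walk_exists[OF assms])
  show "hdist x y \<le> n" if "\<exists>p. walk V p x y \<and> length p = Suc n" for n
    using that walk_length[OF assms(2)] by fastforce
qed

lemma isometric_iff_iso:
  assumes fin: "\<And>v. v \<in> V \<Longrightarrow> finite v"
  shows "isometric V \<longleftrightarrow> iso V"
proof
  assume "iso V"
  then show "isometric V"
    unfolding isometric_def using gdist_eq_hdist walk_exists fin by blast
next
  assume isom: "isometric V"
  show "iso V"
    unfolding iso_def
  proof (intro ballI impI)
    fix x y assume xy: "x \<in> V" "y \<in> V" "x \<noteq> y"
    obtain p0 where "walk V p0 x y"
      using isom xy unfolding isometric_def by blast
    then have "\<exists>p. walk V p x y \<and> length p = Suc (length (tl p0))"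
      by (intro exI[of _ p0]) (cases p0; simp add: walk_def)
    then have "\<exists>n p. walk V p x y \<and> length p = Suc n"
      by blast
    then have "\<exists>p. walk V p x y \<and> length p = Suc (gdist V x y)"
      unfolding gdist_def by (rule LeastI_ex)
    then obtain p where p: "walk V p x y" "length p = Suc (hdist x y)"
      using isom xy unfolding isometric_def by auto
    obtain q where q: "p = x # q"
      using p(1) by (cases p) (auto simp: walk_def)
    have "q \<noteq> []"
      using p(1) xy(3) q by (auto simp: walk_singleton)
    then have w: "adj x (hd q)" "walk V q (hd q) y"
      using p(1) q walk_Cons by metis+
    then have hq: "hd q \<in> V"
      using hd_in_set[OF \<open>q \<noteq> []\<close>] by (auto simp: walk_def)
    from w obtain e where e: "hd q = flip e x"
      by (elim adjE)
    have "e \<in> sd x y"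
    proof (rule ccontr)
      assume "e \<notin> sd x y"
      then have "e \<in> sd (flip e x) y" "finite (sd (flip e x) y)"
        using fin xy by auto
      then have "hdist (flip e x) y = Suc (hdist x y)"
        using card_sd_flip(2)[of "flip e x" y e] by (simp add: hdist_sd)
      then show False
        using walk_length[OF fin w(2)] p(2) q e by simp
    qed
    then show "\<exists>e\<in>sd x y. flip e x \<in> V"
      using hq e by auto
  qed
qed

lemma walk_append:
  assumes "walk V p x z" "walk V (z # q) z y"
  shows "walk V (p @ q) x y"
proof (cases "q = []")
  case True
  then show ?thesis
    using assms by (simp add: walk_singleton)
next
  case False
  then show ?thesis
    using assms by (auto simp: walk_Cons) (auto simp: walk_def successively_append_iff)
qed

lemma walk_split:
  assumes "walk V (p1 @ z # p2) x y"
  shows "walk V (p1 @ [z]) x z" "walk V (z # p2) z y"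
  using assms by (auto simp: walk_def successively_append_iff hd_append successively_Cons)

text \<open>The bridge to coordinates: convexity and gatedness use geodesics only through the
  vertices on them.\<close>

lemma geodesic_through_iff:
  assumes V: "iso V" "\<And>v. v \<in> V \<Longrightarrow> finite v" and xy: "x \<in> V" "y \<in> V"
  shows "(\<exists>p. geodesic V p x y \<and> z \<in> set p) \<longleftrightarrow> z \<in> V \<and> btw x z y"
proof
  assume "\<exists>p. geodesic V p x y \<and> z \<in> set p"
  then obtain p where p: "walk V p x y" "length p = Suc (hdist x y)" "z \<in> set p"
    using gdist_eq_hdist[OF V xy] by (auto simp: geodesic_def)
  then have z: "z \<in> V"
    by (auto simp: walk_def)
  obtain p1 p2 where sp: "p = p1 @ z # p2"
    using p(3) by (meson split_list)
  have "hdist x z < length (p1 @ [z])" "hdist z y < length (z # p2)"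
    using walk_split[of V p1 z p2 x y] p(1) sp walk_length[OF V(2)] by blast+
  then have "hdist x y = hdist x z + hdist z y"
    using p(2) sp hdist_triangle[of x y z] V(2) xy z by simp
  then show "z \<in> V \<and> btw x z y"
    using btw_iff_hdist V(2) xy z by blast
next
  assume z: "z \<in> V \<and> btw x z y"
  then have h: "hdist x y = hdist x z + hdist z y"
    using btw_iff_hdist V(2) xy by blast
  obtain p where p: "walk V p x z" "length p = Suc (hdist x z)"
    using walk_exists[OF V xy(1)] z by blast
  obtain q' where q': "walk V q' z y" "length q' = Suc (hdist z y)"
    using walk_exists[OF V _ xy(2)] z by blast
  then obtain q where q: "q' = z # q"
    by (cases q') (auto simp: walk_def)
  have "walk V (p @ q) x y"
    using walk_append p(1) q' q by blast
  moreover have "z \<in> set (p @ q)"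
    using p(1) last_in_set[of p] by (auto simp: walk_def)
  ultimately show "\<exists>p. geodesic V p x y \<and> z \<in> set p"
    using p q' q h gdist_eq_hdist[OF V xy] unfolding geodesic_def
    by (intro exI[of _ "p @ q"]) simp
qed

lemma convex_iff_conv:
  assumes V: "iso V" "\<And>v. v \<in> V \<Longrightarrow> finite v"
  shows "convex V S \<longleftrightarrow> conv V S"
proof (cases "S \<subseteq> V")
  case True
  have "(\<forall>p. geodesic V p x y \<longrightarrow> set p \<subseteq> S) \<longleftrightarrow> (\<forall>z\<in>V. btw x z y \<longrightarrow> z \<in> S)"
    if "x \<in> S" "y \<in> S" for x y
    using geodesic_through_iff[OF V subsetD[OF True that(1)] subsetD[OF True that(2)]]
    by (metis subset_iff)
  then show ?thesis
    using True unfolding convex_def conv_def by (metis (lifting))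
next
  case False
  then show ?thesis
    unfolding convex_def conv_def by blast
qed

lemma gated_iff_btw:
  assumes V: "iso V" "\<And>v. v \<in> V \<Longrightarrow> finite v" and S: "S \<subseteq> V"
  shows "gated V S \<longleftrightarrow> (\<forall>x\<in>V. \<exists>x'\<in>S. \<forall>y\<in>S. btw x x' y)"
proof -
  have "(\<exists>p. geodesic V p x y \<and> x' \<in> set p) \<longleftrightarrow> btw x x' y" if "x \<in> V" "x' \<in> S" "y \<in> S" for x x' y
    using geodesic_through_iff[OF V that(1) subsetD[OF S that(3)]] subsetD[OF S that(2)] by blast
  then show ?thesis
    unfolding gated_def by (metis (lifting))
qed

section \<open>Antipodal subgraphs as fibres of cells\<close>

definition fibre :: "'a set set \<Rightarrow> 'a set \<Rightarrow> 'a set \<Rightarrow> 'a set set" where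
  "fibre V x K = {y \<in> V. y - K = x - K}"

lemma fibre_iff: "y \<in> fibre V x K \<longleftrightarrow> y \<in> V \<and> (\<forall>k. k \<notin> K \<longrightarrow> (k \<in> y) = (k \<in> x))"
  by (auto simp: fibre_def)

lemma conv_fibre: "conv V (fibre V x K)"
proof (rule convI)
  show "fibre V x K \<subseteq> V"
    by (auto simp: fibre_def)
  fix u v z assume "u \<in> fibre V x K" "v \<in> fibre V x K" "z \<in> V" "btw u z v"
  then show "z \<in> fibre V x K"
    using btwD[of u z v] unfolding fibre_iff by metis
qed

lemma cell_fibre:
  assumes c: "cell V x K" and y: "y \<in> fibre V x K"
  shows "sd y K \<in> fibre V x K" "fibre V y K = fibre V x K" "cell V y K"
proof -
  have y': "y \<in> V" "y - K = x - K"
    using y by (auto simp: fibre_def)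
  have "sd y K - K = x - K"
    using y' by (auto simp: sd_def)
  then show "sd y K \<in> fibre V x K"
    using c y' unfolding cell_def fibre_def by blast
  show "fibre V y K = fibre V x K"
    using y' by (simp add: fibre_def)
  show "cell V y K"
    using c y' by (simp add: cell_def)
qed

lemma cell_self: "cell V x K \<Longrightarrow> x \<in> fibre V x K"
  by (simp add: cell_def fibre_def)

lemma coords_fibre:
  assumes "cell V x K"
  shows "coords (fibre V x K) = K"
proof (rule set_eqI)
  fix e
  have x: "x \<in> fibre V x K" "sd x K \<in> fibre V x K"
    using cell_self[OF assms] cell_fibre[OF assms] by blast+
  show "e \<in> coords (fibre V x K) \<longleftrightarrow> e \<in> K"
  proof
    assume "e \<in> coords (fibre V x K)"
    then obtain u v where "u \<in> fibre V x K" "v \<in> fibre V x K" "e \<in> u" "e \<notin> v"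
      unfolding coords_def by blast
    then show "e \<in> K"
      unfolding fibre_iff by metis
  next
    assume "e \<in> K"
    then have "(e \<in> x) \<noteq> (e \<in> sd x K)"
      by simp
    then show "e \<in> coords (fibre V x K)"
      unfolding coords_def using x by blast
  qed
qed

lemma flip_Int: "e \<in> K \<Longrightarrow> flip e x \<inter> K = flip e (x \<inter> K)"
  by auto

lemma iso_image_Int:
  assumes S: "iso S" and off: "\<And>x y k. x \<in> S \<Longrightarrow> y \<in> S \<Longrightarrow> k \<notin> K \<Longrightarrow> (k \<in> x) = (k \<in> y)"
  shows "iso ((\<lambda>y. y \<inter> K) ` S)"
  unfolding iso_def
proof (intro ballI impI)
  fix u v assume u: "u \<in> (\<lambda>y. y \<inter> K) ` S" and v: "v \<in> (\<lambda>y. y \<inter> K) ` S" and uv: "u \<noteq> v"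
  from u obtain y where y: "u = y \<inter> K" "y \<in> S"
    by (rule imageE)
  from v obtain z where z: "v = z \<inter> K" "z \<in> S"
    by (rule imageE)
  have "y \<noteq> z"
    using uv y z by blast
  then obtain e where e: "e \<in> sd y z" "flip e y \<in> S"
    using isoD[OF S y(2) z(2)] by blast
  then have eK: "e \<in> K"
    using off[OF y(2) z(2), of e] by auto
  then have "e \<in> sd u v"
    using e y z by auto
  moreover have "flip e u \<in> (\<lambda>y. y \<inter> K) ` S"
    using e y flip_Int[OF eK, of y] by (metis image_eqI)
  ultimately show "\<exists>e\<in>sd u v. flip e u \<in> (\<lambda>y. y \<inter> K) ` S"
    by blast
qed

lemma sd_Int: "sd x K \<inter> K = K - (x \<inter> K)"
  by auto

lemma partial_cube_restr_fibre:
  assumes V: "iso V" "\<And>v. v \<in> V \<Longrightarrow> finite v" and c: "cell V x K"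
  shows "partial_cube K (restr (fibre V x K))" "antipodal K (restr (fibre V x K))"
proof -
  let ?S = "fibre V x K" and ?R = "(\<lambda>y. y \<inter> K) ` fibre V x K"
  have R: "restr ?S = ?R"
    by (simp add: restr_def coords_fibre[OF c])
  have x: "x \<in> ?S" "sd x K \<in> ?S"
    using cell_self[OF c] cell_fibre[OF c] by blast+
  then have "finite (sd x (sd x K))"
    using V(2) by (auto simp: fibre_def)
  moreover have "sd x (sd x K) = K"
    by auto
  ultimately have finK: "finite K"
    by simp
  have "iso ?R"
    using iso_image_Int[OF conv_iso[OF V(1) conv_fibre]] unfolding fibre_iff by metis
  then have "isometric ?R"
    using isometric_iff_iso[of ?R] finK by auto
  moreover have "\<exists>u\<in>?R. \<exists>v\<in>?R. e \<in> u \<and> e \<notin> v" if "e \<in> K" for e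
  proof -
    have R: "x \<inter> K \<in> ?R" "sd x K \<inter> K \<in> ?R"
      using x by blast+
    show ?thesis
    proof (cases "e \<in> x")
      case True
      then show ?thesis
        using that by (intro bexI[OF _ R(1)] bexI[OF _ R(2)]) simp
    next
      case False
      then show ?thesis
        using that by (intro bexI[OF _ R(2)] bexI[OF _ R(1)]) simp
    qed
  qed
  moreover have "?R \<noteq> {}" "?R \<subseteq> Pow K"
    using x by blast+
  ultimately show "partial_cube K (restr ?S)"
    unfolding R partial_cube_def using finK by simp
  have "K - u \<in> ?R" if "u \<in> ?R" for u
  proof -
    from that obtain y where y: "u = y \<inter> K" "y \<in> ?S"
      by (rule imageE)
    then have "sd y K \<inter> K \<in> ?R"
      using cell_fibre(1)[OF c] by blast
    then show ?thesis
      using sd_Int[of y K] y(1) by simp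
  qed
  then show "antipodal K (restr ?S)"
    unfolding R antipodal_def by blast
qed

lemma antipodal_subgraph_fibre:
  assumes V: "iso V" "\<And>v. v \<in> V \<Longrightarrow> finite v" and c: "cell V x K"
  shows "antipodal_subgraph V (fibre V x K)"
  unfolding antipodal_subgraph_def coords_fibre[OF c]
  using partial_cube_restr_fibre[OF V c] convex_iff_conv[OF V] conv_fibre by blast

text \<open>Convexity fills the fibre: every vertex agreeing with \<open>x\<close> outside
  \<open>coords S\<close> lies between \<open>x\<close> and its antipode, and both belong to
  \<open>S\<close>.\<close>

lemma antipodal_subgraphE:
  assumes V: "iso V" "\<And>v. v \<in> V \<Longrightarrow> finite v" and S: "antipodal_subgraph V S"
  obtains x where "cell V x (coords S)" "S = fibre V x (coords S)"
proof -
  let ?K = "coords S"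
  have conv: "conv V S" and ne: "restr S \<noteq> {}" and anti: "antipodal ?K (restr S)"
    using S convex_iff_conv[OF V] by (auto simp: antipodal_subgraph_def partial_cube_def)
  then obtain x where x: "x \<in> S"
    by (auto simp: restr_def)
  have off: "(k \<in> y) = (k \<in> z)" if "y \<in> S" "z \<in> S" "k \<notin> ?K" for y z k
    using that unfolding coords_def by blast
  have opp: "sd y ?K \<in> S" if y: "y \<in> S" for y
  proof -
    have "?K - (y \<inter> ?K) \<in> restr S"
      using anti y unfolding antipodal_def restr_def by blast
    then obtain y' where y': "y' \<in> S" "y' \<inter> ?K = ?K - (y \<inter> ?K)"
      unfolding restr_def by auto
    have "k \<in> y' \<longleftrightarrow> k \<in> sd y ?K" for k
      using off[OF y'(1) y, of k] y'(2) by (cases "k \<in> ?K") auto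
    then have "y' = sd y ?K"
      by blast
    then show ?thesis
      using y' by simp
  qed
  have eq: "S = fibre V x ?K"
  proof
    show "S \<subseteq> fibre V x ?K"
    proof
      fix y assume "y \<in> S"
      then show "y \<in> fibre V x ?K"
        using off[OF _ x] conv_subset[OF conv] unfolding fibre_iff by blast
    qed
    show "fibre V x ?K \<subseteq> S"
    proof
      fix y assume "y \<in> fibre V x ?K"
      then have "btw x y (sd x ?K)" "y \<in> V"
        by (auto simp: btw_def fibre_iff)
      then show "y \<in> S"
        using convD[OF conv x opp[OF x]] by blast
    qed
  qed
  have "cell V x ?K"
    unfolding cell_def
  proof (intro conjI ballI impI)
    show "x \<in> V"
      using x conv_subset[OF conv] by blast
    fix y assume "y \<in> V" "y - ?K = x - ?K"
    then have "y \<in> S"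
      using eq by (auto simp: fibre_def)
    then show "sd y ?K \<in> V"
      using opp conv_subset[OF conv] by blast
  qed
  then show thesis
    using that eq by blast
qed

text \<open>A gate of \<open>z\<close> lies between \<open>z\<close> and the antipode of the gate
  itself, which forces it to agree with \<open>z\<close> on \<open>K\<close>.\<close>

lemma gated_fibre_iff:
  assumes V: "iso V" "\<And>v. v \<in> V \<Longrightarrow> finite v" and c: "cell V x K"
  shows "gated V (fibre V x K) \<longleftrightarrow> (\<forall>z\<in>V. proj x K z \<in> V)"
proof -
  have sub: "fibre V x K \<subseteq> V"
    by (auto simp: fibre_def)
  have "(\<exists>x'\<in>fibre V x K. \<forall>y\<in>fibre V x K. btw z x' y) \<longleftrightarrow> proj x K z \<in> V" (is "?L \<longleftrightarrow> ?R") for z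
  proof
    assume ?L
    then obtain x' where x': "x' \<in> fibre V x K" "btw z x' (sd x' K)"
      using cell_fibre(1)[OF c] by blast
    have "k \<in> x' \<longleftrightarrow> k \<in> proj x K z" for k
    proof (cases "k \<in> K")
      case True
      then show ?thesis
        using btwD[OF x'(2), of k] by auto
    next
      case False
      then show ?thesis
        using x'(1) by (simp add: fibre_iff)
    qed
    then have "x' = proj x K z"
      by blast
    then show ?R
      using x'(1) by (simp add: fibre_iff)
  next
    assume ?R
    then have "proj x K z \<in> fibre V x K"
      by (simp add: fibre_iff)
    moreover have "btw z (proj x K z) y" if "y \<in> fibre V x K" for y
      using that by (auto simp: btw_def fibre_iff)
    ultimately show ?L
      by blast
  qed
  then show ?thesis
    using gated_iff_btw[OF V sub] by blast
qed

section \<open>COMs in terms of cells and projections\<close>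

lemma partial_cube_iso:
  assumes "partial_cube E V"
  shows "iso V" "\<And>v. v \<in> V \<Longrightarrow> finite v" "finite V"
proof -
  show fin: "finite v" if "v \<in> V" for v
    using assms that finite_subset unfolding partial_cube_def by blast
  then show "iso V"
    using assms isometric_iff_iso[of V] unfolding partial_cube_def by blast
  show "finite V"
    using assms unfolding partial_cube_def by (meson finite_Pow_iff finite_subset)
qed

lemma COM_iff:
  assumes "partial_cube E V"
  shows "COM E V \<longleftrightarrow> (\<forall>x K. cell V x K \<longrightarrow> (\<forall>z\<in>V. proj x K z \<in> V))"
proof -
  note V = partial_cube_iso(1,2)[OF assms]
  have "(\<forall>S. antipodal_subgraph V S \<longrightarrow> gated V S) \<longleftrightarrow> (\<forall>x K. cell V x K \<longrightarrow> gated V (fibre V x K))"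
    using antipodal_subgraph_fibre[OF V] antipodal_subgraphE[OF V] by metis
  then show ?thesis
    using assms gated_fibre_iff[OF V] unfolding COM_def by metis
qed

lemma COM_com2:
  assumes com: "COM E V" and rank: "rank E V = 2"
  shows "com2 V"
proof
  have pc: "partial_cube E V"
    using com by (simp add: COM_def)
  then have EV: "finite E" "V \<subseteq> Pow E"
    by (auto simp: partial_cube_def)
  show "finite V" "iso V" "\<And>x. x \<in> V \<Longrightarrow> finite x"
    using partial_cube_iso[OF pc] by blast+
  show "proj x K z \<in> V" if "cell V x K" "z \<in> V" for x K z
    using com COM_iff[OF pc] that by blast
  show "\<not> shatters3 V f g h" if distinct: "f \<noteq> g" "f \<noteq> h" "g \<noteq> h" for f g h
  proof
    assume sh: "shatters3 V f g h"
    let ?B = "{f, g, h}" and ?C = "{card B | B. B \<subseteq> E \<and> (\<lambda>x. x \<inter> B) ` V = Pow B}"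
    obtain x where "x \<in> V" "f \<in> x" "g \<in> x" "h \<in> x"
      using sh unfolding shatters3_def by metis
    then have BE: "?B \<subseteq> E"
      using EV by blast
    have "T \<in> (\<lambda>x. x \<inter> ?B) ` V" if "T \<subseteq> ?B" for T
    proof -
      obtain x where "x \<in> V" "(f \<in> x) = (f \<in> T)" "(g \<in> x) = (g \<in> T)" "(h \<in> x) = (h \<in> T)"
        using sh unfolding shatters3_def by metis
      then have "x \<in> V" "T = x \<inter> ?B"
        using that by blast+
      then show ?thesis
        by blast
    qed
    then have "(\<lambda>x. x \<inter> ?B) ` V = Pow ?B"
      by blast
    then have "card ?B \<in> ?C"
      using BE by blast
    moreover have "finite ?C"
      using EV by (intro finite_subset[of ?C "card ` Pow E"]) auto
    ultimately have "card ?B \<le> Max ?C"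
      by simp
    then show False
      using rank distinct unfolding rank_def by simp
  qed
qed

subsection \<open>Corners of even cycles\<close>

lemma sd_sd [simp]: "sd (sd x K) K = x"
  by auto

lemma sd_inject: "sd x K = sd y K \<longleftrightarrow> x = y"
  by (metis sd_sd)

lemma flip_sd: "flip e (sd x K) = sd (flip e x) K"
  by auto

text \<open>An \<open>f\<close>-edge of the cell and the antipodes of its ends show all four
  patterns.\<close>

lemma cell_shatters2:
  assumes V: "iso V" "\<And>v. v \<in> V \<Longrightarrow> finite v" and c: "cell V x K"
    and fg: "f \<in> K" "g \<in> K" "f \<noteq> g"
  shows "shatters2 (fibre V x K) f g"
proof -
  let ?S = "fibre V x K"
  have x: "x \<in> ?S" "sd x K \<in> ?S"
    using cell_self[OF c] cell_fibre[OF c] by blast+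
  then have "finite (sd x (sd x K))"
    using V(2) by (auto simp: fibre_def)
  moreover have "(f \<in> x) \<noteq> (f \<in> sd x K)"
    using fg by simp
  ultimately obtain u where u: "u \<in> ?S" "flip f u \<in> ?S"
    using iso_edge[OF conv_iso[OF V(1) conv_fibre] _ x, of f] by blast
  note opp = cell_fibre(1)[OF c u(1)] cell_fibre(1)[OF c u(2)]
  show ?thesis
    by (rule shatters2I[where b = "f \<in> u" and c = "g \<in> u", OF u(1) opp(2) u(2) opp(1)])
      (use fg in auto)
qed

text \<open>Antipodes supply the missing value of \<open>h\<close> and only permute the patterns of
  \<open>f\<close> and \<open>g\<close>.\<close>

lemma shatters3_if_antipodal:
  assumes "shatters2 A f g" "\<And>t. t \<in> A \<Longrightarrow> (h \<in> t) = b"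
    and "\<And>t. t \<in> A \<Longrightarrow> t \<in> V \<and> sd t J \<in> V" "f \<in> J" "g \<in> J" "h \<in> J"
  shows "shatters3 V f g h"
  unfolding shatters3_def
proof (intro allI)
  fix p q r
  show "\<exists>x\<in>V. (f \<in> x) = p \<and> (g \<in> x) = q \<and> (h \<in> x) = r"
  proof (cases "r = b")
    case True
    obtain t where "t \<in> A" "(f \<in> t) = p" "(g \<in> t) = q"
      using assms(1) unfolding shatters2_def by blast
    then show ?thesis
      using True assms(2,3)[of t] by blast
  next
    case False
    obtain t where t: "t \<in> A" "(f \<in> t) = (\<not> p)" "(g \<in> t) = (\<not> q)"
      using assms(1) unfolding shatters2_def by blast
    then have "sd t J \<in> V" "(f \<in> sd t J) = p" "(g \<in> sd t J) = q" "(h \<in> sd t J) = r"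
      using False assms(2,3)[of t] assms(4-) by auto
    then show ?thesis
      by blast
  qed
qed

lemma Diff_sd: "y \<subseteq> E \<Longrightarrow> E - y = sd y E"
  by auto

text \<open>A proper cell with two classes shatters them while some class outside stays constant on
  it; antipodes in \<open>Y\<close> would complete a shattered triple.\<close>

lemma antipodal_cell_cases:
  assumes pc: "partial_cube E Y" and ap: "antipodal E Y"
    and rank: "\<And>f g h. f \<noteq> g \<Longrightarrow> f \<noteq> h \<Longrightarrow> g \<noteq> h \<Longrightarrow> \<not> shatters3 Y f g h"
    and c: "cell Y x J"
  shows "J = E \<or> J = {} \<or> (\<exists>j. J = {j})"
proof (rule ccontr)
  assume no: "\<not> ?thesis"
  note V = partial_cube_iso(1,2)[OF pc]
  have sub: "y \<subseteq> E" if "y \<in> Y" for y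
    using pc that by (auto simp: partial_cube_def)
  have mem: "x \<in> Y" "sd x J \<in> Y"
    using cell_self[OF c] cell_fibre(1)[OF c] by (auto simp: fibre_def)
  have "J \<subseteq> E"
  proof
    fix k assume "k \<in> J"
    then have "k \<in> x \<or> k \<in> sd x J"
      by auto
    then show "k \<in> E"
      using sub mem by blast
  qed
  then obtain f g h where fgh: "f \<in> J" "g \<in> J" "f \<noteq> g" "h \<in> E" "h \<notin> J"
    using no by blast
  have "sd t E \<in> Y" if "t \<in> Y" for t
    using ap that Diff_sd[OF sub[OF that]] unfolding antipodal_def by metis
  then have "shatters3 Y f g h"
    using shatters3_if_antipodal[OF cell_shatters2[OF V c fgh(1-3)], of h "h \<in> x" Y E] fgh \<open>J \<subseteq> E\<close>
    by (auto simp: fibre_iff)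
  then show False
    using rank[of f g h] fgh by blast
qed

lemma proj_full: "z \<subseteq> E \<Longrightarrow> x \<subseteq> E \<Longrightarrow> proj x E z = z"
  by (auto simp: proj_def)

text \<open>Gates are automatic when every cell is the whole graph, a vertex or an edge.\<close>

lemma OM_if_antipodal:
  assumes pc: "partial_cube E Y" and ap: "antipodal E Y"
    and rank: "\<And>f g h. f \<noteq> g \<Longrightarrow> f \<noteq> h \<Longrightarrow> g \<noteq> h \<Longrightarrow> \<not> shatters3 Y f g h"
  shows "OM E Y"
proof -
  have "proj x J z \<in> Y" if c: "cell Y x J" and z: "z \<in> Y" for x J z
  proof -
    have x: "x \<in> Y" "sd x J \<in> Y"
      using cell_self[OF c] cell_fibre(1)[OF c] by (auto simp: fibre_def)
    have sub: "y \<subseteq> E" if "y \<in> Y" for y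
      using pc that by (auto simp: partial_cube_def)
    consider "J = E" | "J = {}" | j where "J = {j}"
      using antipodal_cell_cases[OF pc ap rank c] by blast
    then show ?thesis
    proof cases
      case 1
      then show ?thesis
        using proj_full[OF sub[OF z] sub[OF x(1)]] z by simp
    next
      case 2
      then show ?thesis
        using x by (simp add: proj_def)
    next
      case 3
      then have "proj x J z = x \<or> proj x J z = sd x J"
        unfolding set_eq_iff by auto
      then show ?thesis
        using x by metis
    qed
  qed
  then have "COM E Y"
    using COM_iff[OF pc] by blast
  then show ?thesis
    using ap by (simp add: OM_def)
qed

lemma edge_cell:
  assumes "x \<in> V" "flip e x \<in> V"
  shows "cell V x {e}" "fibre V x {e} = {x, flip e x}"
proof -
  have two: "y = x \<or> y = flip e x" if "y - {e} = x - {e}" for y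
    using that unfolding set_eq_iff by (metis Diff_iff mem_flip singletonD singletonI)
  have "sd x {e} = flip e x" "sd (flip e x) {e} = x"
    by auto
  then show "cell V x {e}"
    using assms two unfolding cell_def by metis
  have "flip e x - {e} = x - {e}"
    by auto
  then show "fibre V x {e} = {x, flip e x}"
    using assms two unfolding fibre_def by blast
qed

lemma point_cell:
  assumes "x \<in> V"
  shows "cell V x {}" "fibre V x {} = {x}"
proof -
  have "sd x {} = x"
    by auto
  then show "cell V x {}"
    using assms by (simp add: cell_def)
  show "fibre V x {} = {x}"
    using assms by (auto simp: fibre_def)
qed

text \<open>Vertices of the cube in which \<open>expansion\<close> lives, with \<open>None\<close>
  as its new class; \<open>c\<close> selects the side of the copy of \<open>x\<close>.\<close>

definition emb :: "bool \<Rightarrow> 'a set \<Rightarrow> 'a option set" where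
  "emb c x = {u. case u of None \<Rightarrow> c | Some k \<Rightarrow> k \<in> x}"

lemma mem_emb [simp]: "None \<in> emb c x \<longleftrightarrow> c" "Some k \<in> emb c x \<longleftrightarrow> k \<in> x"
  by (simp_all add: emb_def)

lemma emb_eqI: "(None \<in> u) = c \<Longrightarrow> (\<And>k. Some k \<in> u \<longleftrightarrow> k \<in> x) \<Longrightarrow> u = emb c x"
  by (auto simp: emb_def split: option.splits)
    (metis not_Some_eq)+

lemma emb_inject [simp]: "emb c x = emb d y \<longleftrightarrow> c = d \<and> x = y"
proof
  assume e: "emb c x = emb d y"
  have "k \<in> x \<longleftrightarrow> k \<in> y" for k
    using mem_emb(2)[of k c x] mem_emb(2)[of k d y] e by simp
  then show "c = d \<and> x = y"
    using mem_emb(1)[of c x] mem_emb(1)[of d y] e by auto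
qed simp

lemma vimage_emb [simp]: "Some -` emb c x = x"
  by auto

lemma flip_emb: "flip None (emb c x) = emb (\<not> c) x" "flip (Some k) (emb c x) = emb c (flip k x)"
  by (rule emb_eqI; simp)+

lemma Diff_emb: "insert None (Some ` K) - emb c x = emb (\<not> c) (K - x)"
  by (rule emb_eqI) auto

lemma emb_subset: "x \<subseteq> K \<Longrightarrow> emb c x \<subseteq> insert None (Some ` K)"
proof
  fix u assume "x \<subseteq> K" "u \<in> emb c x"
  then show "u \<in> insert None (Some ` K)"
    by (cases u) auto
qed

text \<open>A cycle of length 2 * card K, given as a maximal chain H (relative to the vertex b)
  together with its antipodes; the expansion along H is the cycle of length 2 * card K + 2.\<close>

locale antipodal_cycle =
  fixes K :: "'a set" and Y H :: "'a set set" and b :: "'a set"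
  assumes pc: "partial_cube K Y" and ap: "antipodal K Y"
    and rank2: "f \<noteq> g \<Longrightarrow> f \<noteq> h \<Longrightarrow> g \<noteq> h \<Longrightarrow> \<not> shatters3 Y f g h"
    and not_edge: "K \<noteq> {}" "K \<noteq> {j}"
    and ends: "b \<in> H" "sd b K \<in> H"
    and chain: "x \<in> H \<Longrightarrow> y \<in> H \<Longrightarrow> sd x b \<subseteq> sd y b \<or> sd y b \<subseteq> sd x b"
    and iso_H: "iso H"
    and Y_eq: "Y = H \<union> (\<lambda>x. sd x K) ` H"
begin

definition H' :: "'a set set" where "H' = (\<lambda>x. sd x K) ` H"

text \<open>The paths \<open>H\<close> and \<open>H'\<close> share exactly \<open>b\<close> and
  \<open>sd b K\<close>, and these become the two edges of the new class.\<close>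

definition G' :: "'a option set set" where "G' = emb True ` H \<union> emb False ` H'"

lemma mem_H': "x \<in> H' \<longleftrightarrow> sd x K \<in> H"
  unfolding H'_def by (metis (no_types, lifting) image_iff sd_sd)

lemma mem_Y: "x \<in> Y \<longleftrightarrow> x \<in> H \<or> x \<in> H'"
  by (auto simp: Y_eq H'_def)

lemma mem_G': "emb c x \<in> G' \<longleftrightarrow> (if c then x \<in> H else x \<in> H')"
  by (auto simp: G'_def)

lemma G'_cases:
  assumes "u \<in> G'"
  obtains c x where "u = emb c x" "if c then x \<in> H else x \<in> H'"
proof -
  from assms consider "u \<in> emb True ` H" | "u \<in> emb False ` H'"
    unfolding G'_def by blast
  then show thesis
  proof cases
    case 1
    then obtain x where "u = emb True x" "x \<in> H"
      by (rule imageE)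
    then show thesis
      using that[of True x] by simp
  next
    case 2
    then obtain x where "u = emb False x" "x \<in> H'"
      by (rule imageE)
    then show thesis
      using that[of False x] by simp
  qed
qed

lemma Y_sub: "x \<in> Y \<Longrightarrow> x \<subseteq> K"
  using pc by (auto simp: partial_cube_def)

text \<open>An inner vertex of the path has a neighbour towards each end. If neither were closer to
  \<open>t\<close>, the difference sets of \<open>s\<close> and of the antipode of \<open>t\<close>
  from \<open>b\<close> would be incomparable.\<close>

lemma H_step:
  assumes s: "s \<in> H" and t: "t \<in> H'"
  shows "s \<in> H' \<or> (\<exists>e\<in>sd s t. flip e s \<in> H)"
proof (cases "s = b \<or> s = sd b K")
  case True
  then show ?thesis
    using ends by (auto simp: mem_H')
next
  case False
  then obtain f g where f: "f \<in> sd s b" "flip f s \<in> H" and g: "g \<in> sd s (sd b K)" "flip g s \<in> H"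
    using isoD[OF iso_H s ends(1)] isoD[OF iso_H s ends(2)] by blast
  have sub: "s \<subseteq> K" "b \<subseteq> K"
    using Y_sub mem_Y s ends by blast+
  then have gk: "g \<in> K" "f \<in> K"
    using g f by auto
  have "f \<in> sd s t \<or> g \<in> sd s t"
  proof (rule ccontr)
    assume no: "\<not> ?thesis"
    have "f \<notin> sd (sd t K) b" "f \<in> sd s b" "g \<in> sd (sd t K) b" "g \<notin> sd s b"
      using no f g gk by auto
    then show False
      using chain[OF s, of "sd t K"] t unfolding mem_H' by blast
  qed
  then show ?thesis
    using f g by blast
qed

lemma H'_step:
  assumes s: "s \<in> H'" and t: "t \<in> H"
  shows "s \<in> H \<or> (\<exists>e\<in>sd s t. flip e s \<in> H')"
proof -
  have "sd s K \<in> H' \<or> (\<exists>e\<in>sd (sd s K) (sd t K). flip e (sd s K) \<in> H)"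
    using H_step[of "sd s K" "sd t K"] s t by (simp add: mem_H')
  moreover have "sd (sd s K) (sd t K) = sd s t"
    by auto
  ultimately show ?thesis
    by (simp add: mem_H' flip_sd)
qed

lemma iso_H': "iso H'"
  unfolding iso_def
proof (intro ballI impI)
  fix x y assume xy: "x \<in> H'" "y \<in> H'" "x \<noteq> y"
  then obtain e where "e \<in> sd (sd x K) (sd y K)" "flip e (sd x K) \<in> H"
    using isoD[OF iso_H, of "sd x K" "sd y K"] by (auto simp: mem_H' sd_inject simp del: mem_sd)
  moreover have "sd (sd x K) (sd y K) = sd x y"
    by auto
  ultimately show "\<exists>e\<in>sd x y. flip e x \<in> H'"
    by (auto simp: mem_H' flip_sd simp del: mem_sd)
qed

lemma iso_G': "iso G'"
  unfolding iso_def
proof (intro ballI impI)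
  fix u v assume u: "u \<in> G'" and v: "v \<in> G'" and uv: "u \<noteq> v"
  obtain c x where x: "u = emb c x" "if c then x \<in> H else x \<in> H'"
    using G'_cases[OF u] .
  obtain d y where y: "v = emb d y" "if d then y \<in> H else y \<in> H'"
    using G'_cases[OF v] .
  have "(c \<noteq> d \<and> emb (\<not> c) x \<in> G') \<or> (\<exists>e\<in>sd x y. emb c (flip e x) \<in> G')"
  proof (cases "c = d")
    case True
    then have "x \<noteq> y"
      using uv x y by simp
    then show ?thesis
      using True x y isoD[OF iso_H, of x y] isoD[OF iso_H', of x y] by (cases c) (auto simp: mem_G')
  next
    case False
    then show ?thesis
      using x y H_step[of x y] H'_step[of x y] by (cases c; cases d) (auto simp: mem_G')
  qed
  then show "\<exists>e\<in>sd u v. flip e u \<in> G'"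
  proof
    assume "c \<noteq> d \<and> emb (\<not> c) x \<in> G'"
    then show ?thesis
      using x y by (intro bexI[of _ None]) (auto simp: flip_emb)
  next
    assume "\<exists>e\<in>sd x y. emb c (flip e x) \<in> G'"
    then obtain e where "e \<in> sd x y" "emb c (flip e x) \<in> G'"
      by blast
    then show ?thesis
      using x y by (intro bexI[of _ "Some e"]) (auto simp: flip_emb)
  qed
qed

lemma partial_cube_G': "partial_cube (insert None (Some ` K)) G'"
proof -
  have finK: "finite K"
    using pc by (simp add: partial_cube_def)
  have sub: "u \<subseteq> insert None (Some ` K)" if "u \<in> G'" for u
    using that emb_subset Y_sub mem_Y by (auto simp: G'_def)
  then have "finite u" if "u \<in> G'" for u
    using that finK finite_subset[of u "insert None (Some ` K)"] by simp
  then have "isometric G'"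
    using isometric_iff_iso[of G'] iso_G' by blast
  moreover have "\<exists>x\<in>G'. \<exists>y\<in>G'. e \<in> x \<and> e \<notin> y" if e: "e \<in> insert None (Some ` K)" for e
  proof (cases e)
    case None
    have "emb True b \<in> G'" "emb False b \<in> G'"
      using ends by (auto simp: mem_G' mem_H')
    then show ?thesis
      unfolding None by (metis mem_emb(1))
  next
    case (Some k)
    have "emb True b \<in> G'" "emb True (sd b K) \<in> G'"
      using ends by (auto simp: mem_G')
    moreover have "k \<in> K"
      using e Some by auto
    then have "(Some k \<in> emb True b) \<noteq> (Some k \<in> emb True (sd b K))"
      by simp
    ultimately show ?thesis
      unfolding Some by metis
  qed
  moreover have "G' \<noteq> {}"
    using ends by (auto simp: G'_def)
  ultimately show ?thesis
    using finK sub unfolding partial_cube_def by (auto simp del: mem_sd)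
qed

lemma chain_not_shatters2: "\<not> shatters2 H f g"
proof
  assume sh: "shatters2 H f g"
  obtain x y where x: "x \<in> H" "(f \<in> x) = (f \<notin> b)" "(g \<in> x) = (g \<in> b)"
    and y: "y \<in> H" "(f \<in> y) = (f \<in> b)" "(g \<in> y) = (g \<notin> b)"
    using sh unfolding shatters2_def by metis
  then have "f \<in> sd x b" "f \<notin> sd y b" "g \<in> sd y b" "g \<notin> sd x b"
    by auto
  then show False
    using chain[OF x(1) y(1)] by blast
qed

text \<open>If the new class is among the three, the chain \<open>H\<close> would shatter the other
  two; if not, \<open>Y\<close> would shatter all three.\<close>

lemma rank2_G':
  assumes "u \<noteq> v" "u \<noteq> w" "v \<noteq> w"
  shows "\<not> shatters3 G' u v w"
proof
  assume sh: "shatters3 G' u v w"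
  have none: False if "\<And>p q. \<exists>x\<in>G'. None \<in> x \<and> (Some f \<in> x) = p \<and> (Some g \<in> x) = q" for f g
  proof -
    have "shatters2 H f g"
      unfolding shatters2_def
    proof (intro allI)
      fix p q
      from that[of p q]
      obtain x where x: "x \<in> G'" "None \<in> x" "(Some f \<in> x) = p" "(Some g \<in> x) = q"
        by (elim bexE conjE)
      obtain c y where "x = emb c y" "if c then y \<in> H else y \<in> H'"
        using G'_cases[OF x(1)] .
      then show "\<exists>x\<in>H. (f \<in> x) = p \<and> (g \<in> x) = q"
        using x by auto
    qed
    then show False
      using chain_not_shatters2 by blast
  qed
  show False
  proof (cases "None \<in> {u, v, w}")
    case True
    then consider f g where "u = None" "v = Some f" "w = Some g"
      | f g where "v = None" "u = Some f" "w = Some g"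
      | f g where "w = None" "u = Some f" "v = Some g"
      using assms by (metis insertE not_Some_eq singletonD)
    then show False
    proof cases
      case (1 f g)
      show False
        by (rule none[of f g]) (use sh 1 in \<open>unfold shatters3_def, metis (full_types)\<close>)
    next
      case (2 f g)
      show False
        by (rule none[of f g]) (use sh 2 in \<open>unfold shatters3_def, metis (full_types)\<close>)
    next
      case (3 f g)
      show False
        by (rule none[of f g]) (use sh 3 in \<open>unfold shatters3_def, metis (full_types)\<close>)
    qed
  next
    case False
    then obtain f g h where fgh: "u = Some f" "v = Some g" "w = Some h"
      by (metis insertCI not_Some_eq)
    have "shatters3 Y f g h"
      unfolding shatters3_def
    proof (intro allI)
      fix p q r
      obtain x where x: "x \<in> G'" "(u \<in> x) = p" "(v \<in> x) = q" "(w \<in> x) = r"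
        using sh unfolding shatters3_def by blast
      obtain c y where y: "x = emb c y" "if c then y \<in> H else y \<in> H'"
        using G'_cases[OF x(1)] .
      then have "y \<in> Y"
        unfolding mem_Y by (cases c) auto
      then show "\<exists>x\<in>Y. (f \<in> x) = p \<and> (g \<in> x) = q \<and> (h \<in> x) = r"
        using x y(1) fgh by auto
    qed
    then show False
      using rank2[of f g h] assms fgh by blast
  qed
qed

lemma OM_G': "OM (insert None (Some ` K)) G'"
proof (rule OM_if_antipodal[OF partial_cube_G' _ rank2_G'])
  show "antipodal (insert None (Some ` K)) G'"
    unfolding antipodal_def
  proof
    fix u assume "u \<in> G'"
    then obtain c x where x: "u = emb c x" "if c then x \<in> H else x \<in> H'"
      by (rule G'_cases)
    then have "x \<in> Y"
      unfolding mem_Y by (cases c) auto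
    then have "K - x = sd x K"
      using Diff_sd Y_sub by blast
    then show "insert None (Some ` K) - u \<in> G'"
      using x by (cases c) (auto simp: Diff_emb mem_G' mem_H')
  qed
qed

lemma exp_H: "exp_H1 G' = H" "exp_H2 G' = H'"
proof -
  have "{x \<in> G'. None \<in> x} = emb True ` H" "{x \<in> G'. None \<notin> x} = emb False ` H'"
    by (auto simp: G'_def)
  then show "exp_H1 G' = H" "exp_H2 G' = H'"
    unfolding exp_H1_def exp_H2_def by (simp_all add: image_image)
qed

lemma expansion_G': "expansion K Y G'"
proof -
  have "(\<lambda>x. Some -` x) ` G' = Y"
    unfolding G'_def by (simp add: image_Un image_image Y_eq H'_def)
  then show ?thesis
    using partial_cube_G' by (simp add: expansion_def)
qed

text \<open>For a common vertex, \<open>sd x b\<close> is comparable with its complement in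
  \<open>K\<close>, so one of them is empty.\<close>

lemma H_Int_H': "x \<in> H \<Longrightarrow> x \<in> H' \<Longrightarrow> x = b \<or> x = sd b K"
proof -
  assume x: "x \<in> H" "x \<in> H'"
  have sub: "x \<subseteq> K" "b \<subseteq> K"
    using Y_sub mem_Y x ends by blast+
  have "sd x b \<subseteq> sd (sd x K) b \<or> sd (sd x K) b \<subseteq> sd x b"
    using chain x by (simp add: mem_H')
  moreover have "sd (sd x K) b = K - sd x b"
    using sub by auto
  ultimately have "sd x b = {} \<or> sd x b = K"
    using sub by auto
  then have "x = sd b {} \<or> x = sd b K"
    by (metis sd_def sd_sd Un_commute)
  then show "x = b \<or> x = sd b K"
    by (auto simp: sd_def)
qed

text \<open>The maximal proper antipodal subgraphs are the edges, since every vertex lies on one.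
  \<open>H_step\<close> or \<open>H'_step\<close>, aimed at the other end of an edge, can only move
  along it, so the edge lies in one of the paths. It is not in both because \<open>b\<close> and
  \<open>sd b K\<close> are not adjacent.\<close>

lemma general_position_G': "general_position Y G'"
  unfolding general_position_def exp_H
proof (intro allI impI)
  fix S assume "max_proper_antipodal Y S"
  then have S: "antipodal_subgraph Y S" "S \<noteq> Y"
    and maxS: "\<And>T. antipodal_subgraph Y T \<Longrightarrow> T \<noteq> Y \<Longrightarrow> S \<subseteq> T \<Longrightarrow> T = S"
    unfolding max_proper_antipodal_def by blast+
  note V = partial_cube_iso(1,2)[OF pc]
  obtain x where c: "cell Y x (coords S)" and S_eq: "S = fibre Y x (coords S)"
    using antipodal_subgraphE[OF V S(1)] .
  have x: "x \<in> Y"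
    using c by (simp add: cell_def)
  have edge_neq: "fibre Y u {e} \<noteq> Y" if "cell Y u {e}" for u e
  proof
    assume "fibre Y u {e} = Y"
    then have "b \<in> fibre Y u {e}" "sd b K \<in> fibre Y u {e}"
      using ends mem_Y by blast+
    then have "(k \<in> b) = (k \<in> sd b K)" if "k \<noteq> e" for k
      using that unfolding fibre_iff by blast
    then have "K \<subseteq> {e}"
      by auto
    then show False
      using not_edge by blast
  qed
  have "coords S \<noteq> K"
  proof
    assume "coords S = K"
    then have "S = Y"
      using S_eq Y_sub x by (auto simp: fibre_def)
    then show False
      using S by blast
  qed
  moreover have "coords S \<noteq> {}"
  proof
    assume e: "coords S = {}"
    have "sd x K \<in> Y"
      using x mem_Y mem_H' by auto
    moreover have "x \<noteq> sd x K"
      using not_edge(1) by auto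
    ultimately obtain e where "flip e x \<in> Y"
      using isoD[OF V(1) x] by blast
    then have c': "cell Y x {e}" and fib: "fibre Y x {e} = {x, flip e x}"
      using edge_cell[OF x] by simp_all
    have "S = {x}"
      using S_eq point_cell(2)[OF x] e by simp
    then have "fibre Y x {e} = S"
      using maxS[OF antipodal_subgraph_fibre[OF V c'] edge_neq[OF c']] fib by blast
    then show False
      using coords_fibre[OF c'] \<open>coords S = {}\<close> by simp
  qed
  ultimately obtain j where j: "coords S = {j}"
    using antipodal_cell_cases[OF pc ap rank2 c] by blast
  have cj: "cell Y x {j}"
    using c j by simp
  have "sd x {j} \<in> Y"
    using cell_fibre(1)[OF cj cell_self[OF cj]] by (simp add: fibre_def)
  then have fx: "flip j x \<in> Y"
    by (simp add: flip_def)
  have S2: "S = {x, flip j x}"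
    using S_eq edge_cell(2)[OF x fx] j by simp
  have sdj: "sd x (flip j x) = {j}"
    by auto
  have "S \<subseteq> H \<or> S \<subseteq> H'"
  proof (cases "x \<in> H")
    case True
    then show ?thesis
      using H_step[of x "flip j x"] fx S2 unfolding mem_Y sdj by blast
  next
    case False
    then show ?thesis
      using H'_step[of x "flip j x"] fx S2 x unfolding mem_Y sdj by blast
  qed
  moreover have "\<not> S \<subseteq> H \<inter> H'"
  proof
    assume "S \<subseteq> H \<inter> H'"
    then have "(x = b \<or> x = sd b K) \<and> (flip j x = b \<or> flip j x = sd b K)"
      using H_Int_H' S2 by blast
    then have "sd b K = flip j b"
      by (metis flip_flip flip_neq(1))
    then have "K = {j}"
      unfolding flip_def set_eq_iff by auto
    then show False
      using not_edge by blast
  qed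
  ultimately show "(S \<subseteq> H \<or> S \<subseteq> H') \<and> \<not> S \<subseteq> H \<inter> H'" ..
qed

lemma OM_corner_cycle: "OM_corner K Y (Y - H)"
  unfolding OM_corner_def
  using OM_if_antipodal[OF pc ap rank2] OM_G' expansion_G' general_position_G' exp_H by metis

end

subsection \<open>Corner peelings\<close>

lemma rank_le_card:
  assumes "finite K" "Y \<noteq> {}"
  shows "rank K Y \<le> card K"
proof -
  let ?C = "{card B | B. B \<subseteq> K \<and> (\<lambda>x. x \<inter> B) ` Y = Pow B}"
  have "finite ?C"
    using assms(1) by (intro finite_subset[of ?C "card ` Pow K"]) auto
  moreover have "(\<lambda>x. x \<inter> {}) ` Y = Pow {}"
    using assms(2) by auto
  then have "?C \<noteq> {}"
    by blast
  ultimately have "Max ?C \<in> ?C"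
    by (rule Max_in)
  then show ?thesis
    unfolding rank_def using card_mono[OF assms(1)] by (elim CollectE exE conjE) simp
qed

lemma coords_mono: "S \<subseteq> T \<Longrightarrow> coords S \<subseteq> coords T"
  unfolding coords_def by blast

lemma fibre_mono: "J \<subseteq> K \<Longrightarrow> fibre V x J \<subseteq> fibre V x K"
  unfolding fibre_iff[abs_def] subset_iff by (auto simp: fibre_iff)

context com2
begin

lemma max_antipodal_fibre:
  assumes c: "cell V x K" and max: "\<And>J. cell V x J \<Longrightarrow> K \<subseteq> J \<Longrightarrow> J = K"
  shows "max_antipodal V (fibre V x K)"
  unfolding max_antipodal_def
proof (intro conjI allI impI)
  show "antipodal_subgraph V (fibre V x K)"
    by (rule antipodal_subgraph_fibre[OF iso_V finite_elem c])
  fix T assume T: "antipodal_subgraph V T \<and> fibre V x K \<subseteq> T"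
  then have apT: "antipodal_subgraph V T"
    by blast
  obtain y where y: "cell V y (coords T)" "T = fibre V y (coords T)"
    using antipodal_subgraphE[OF iso_V finite_elem apT] .
  have "x \<in> fibre V y (coords T)"
    using T cell_self[OF c] y(2) by blast
  then have "cell V x (coords T)" "fibre V x (coords T) = T"
    using cell_fibre[OF y(1)] y(2) by simp_all
  moreover have "K \<subseteq> coords T"
    using coords_mono[of "fibre V x K" T] T coords_fibre[OF c] by simp
  ultimately show "T = fibre V x K"
    using max by metis
qed

text \<open>Any other maximal antipodal subgraph meeting \<open>C\<close> would have classes
  comparable with \<open>K\<close>, hence be comparable with the fibre, and two comparable maximal
  ones coincide.\<close>

lemma COM_cornerI:
  assumes c: "cell V x K" and max: "\<And>J. cell V x J \<Longrightarrow> K \<subseteq> J \<Longrightarrow> J = K"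
    and C: "C \<subseteq> fibre V x K"
    and only: "\<And>y J. y \<in> C \<Longrightarrow> cell V y J \<Longrightarrow> J \<subseteq> K \<or> K \<subseteq> J"
    and OM: "OM_corner K (restr (fibre V x K)) ((\<lambda>y. y \<inter> K) ` C)"
  shows "COM_corner V C"
  unfolding COM_corner_def
proof (intro exI[of _ "fibre V x K"] conjI allI impI)
  show maxK: "max_antipodal V (fibre V x K)"
    by (rule max_antipodal_fibre[OF c max])
  show "C \<subseteq> fibre V x K" by fact
  show "OM_corner (coords (fibre V x K)) (restr (fibre V x K))
      ((\<lambda>y. y \<inter> coords (fibre V x K)) ` C)"
    using OM by (simp add: coords_fibre[OF c])
  fix T assume T: "max_antipodal V T \<and> T \<noteq> fibre V x K"
  then have apT: "antipodal_subgraph V T"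
    by (simp add: max_antipodal_def)
  obtain t where t: "cell V t (coords T)" "T = fibre V t (coords T)"
    using antipodal_subgraphE[OF iso_V finite_elem apT] .
  show "T \<inter> C = {}"
  proof (rule ccontr)
    assume "T \<inter> C \<noteq> {}"
    then obtain y where y: "y \<in> T" "y \<in> C"
      by blast
    then have "y \<in> fibre V t (coords T)"
      using t(2) by simp
    then have cy: "cell V y (coords T)" "fibre V y (coords T) = T"
      using cell_fibre[OF t(1)] t(2) by simp_all
    have yK: "fibre V y K = fibre V x K"
      using cell_fibre(2)[OF c] y C by blast
    have "T \<subseteq> fibre V x K \<or> fibre V x K \<subseteq> T"
      using only[OF y(2) cy(1)] fibre_mono[of "coords T" K V y] fibre_mono[of K "coords T" V y]
        cy(2) yK by auto
    then show False
      using T maxK apT unfolding max_antipodal_def by blast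
  qed
qed

lemma no_shatters3_restr: "f \<noteq> g \<Longrightarrow> f \<noteq> h \<Longrightarrow> g \<noteq> h \<Longrightarrow> \<not> shatters3 ((\<lambda>y. y \<inter> K) ` fibre V x K) f g h"
proof
  assume distinct: "f \<noteq> g" "f \<noteq> h" "g \<noteq> h"
    and sh: "shatters3 ((\<lambda>y. y \<inter> K) ` fibre V x K) f g h"
  obtain u where "u \<in> (\<lambda>y. y \<inter> K) ` fibre V x K" "f \<in> u" "g \<in> u" "h \<in> u"
    using sh unfolding shatters3_def by metis
  then have K: "f \<in> K" "g \<in> K" "h \<in> K"
    by auto
  have "shatters3 V f g h"
    unfolding shatters3_def
  proof (intro allI)
    fix p q r
    obtain y where "y \<in> fibre V x K" "(f \<in> y \<inter> K) = p" "(g \<in> y \<inter> K) = q" "(h \<in> y \<inter> K) = r"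
      using sh unfolding shatters3_def by blast
    then show "\<exists>x\<in>V. (f \<in> x) = p \<and> (g \<in> x) = q \<and> (h \<in> x) = r"
      using K by (intro bexI[of _ y]) (simp_all add: fibre_def)
  qed
  then show False
    using rank2[OF distinct] by blast
qed

lemma restr_fibre: "cell V x K \<Longrightarrow> restr (fibre V x K) = (\<lambda>y. y \<inter> K) ` fibre V x K"
  by (simp add: restr_def coords_fibre)

text \<open>Vertices and edges fall under the rank 1 clause of \<open>OM_corner\<close>.\<close>

lemma OM_corner_small:
  assumes c: "cell V p K" and K: "finite K" "card K \<le> 1"
  shows "OM_corner K (restr (fibre V p K)) ((\<lambda>y. y \<inter> K) ` {p})"
proof -
  have "OM K (restr (fibre V p K))"
    using OM_if_antipodal partial_cube_restr_fibre[OF iso_V finite_elem c]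
      no_shatters3_restr unfolding restr_fibre[OF c] by blast
  moreover have p: "p \<inter> K \<in> restr (fibre V p K)"
    using cell_self[OF c] by (simp add: restr_fibre[OF c])
  then have "rank K (restr (fibre V p K)) \<le> 1"
    using rank_le_card[OF K(1), of "restr (fibre V p K)"] K(2) by force
  ultimately show ?thesis
    unfolding OM_corner_def using p by auto
qed

lemma COM_corner_singleton:
  assumes "V = {p}"
  shows "COM_corner V {p}"
proof (rule COM_cornerI[where x = p and K = "{}"])
  have p: "p \<in> V"
    using assms by simp
  show c: "cell V p {}"
    by (rule point_cell[OF p])
  show "J = {}" if "cell V p J" for J
  proof -
    have "sd p J = p"
      using cell_fibre(1)[OF that cell_self[OF that]] assms by (auto simp: fibre_def simp del: mem_sd)
    then show ?thesis
      by auto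
  qed
  show "{p} \<subseteq> fibre V p {}"
    using point_cell(2)[OF p] by simp
  show "J \<subseteq> {} \<or> {} \<subseteq> J" for J :: "'a set"
    by blast
  show "OM_corner {} (restr (fibre V p {})) ((\<lambda>y. y \<inter> {}) ` {p})"
    by (rule OM_corner_small[OF c]) simp_all
qed

lemma COM_corner_pendant:
  assumes p: "pendant V p f"
  shows "COM_corner V {p}"
proof (rule COM_cornerI[where x = p and K = "{f}"])
  have pV: "p \<in> V" "flip f p \<in> V"
    using p by (auto simp: pendant_def)
  show c: "cell V p {f}"
    by (rule edge_cell[OF pV])
  have opp: "sd y J \<in> V" if "cell V p J" "y \<in> fibre V p J" for y J
    using cell_fibre(1)[OF that] by (simp add: fibre_def)
  show "J = {f}" if J: "cell V p J" "{f} \<subseteq> J" for J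
  proof (rule ccontr)
    assume "J \<noteq> {f}"
    then obtain j where j: "j \<in> J" "j \<noteq> f"
      using J(2) by blast
    have "flip f p \<in> fibre V p J"
      using pV J(2) by (auto simp: fibre_iff)
    then have "sd (flip f p) J \<in> V"
      by (rule opp[OF J(1)])
    moreover have "(j \<in> sd (flip f p) J) \<noteq> (j \<in> p)"
      using j by simp
    then have "sd (flip f p) J \<noteq> p"
      by blast
    moreover have "(f \<in> sd (flip f p) J) = (f \<in> p)"
      using J(2) by auto
    ultimately show False
      using pendant_separated[OF p] by blast
  qed
  show "{p} \<subseteq> fibre V p {f}"
    using cell_self[OF c] by simp
  show "J \<subseteq> {f} \<or> {f} \<subseteq> J" if y: "y \<in> {p}" and J: "cell V y J" for y J
  proof (cases "J = {}")
    case False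
    have "cell V p J"
      using J y by simp
    then have "sd p J \<in> V"
      using opp cell_self by blast
    moreover have "sd p J \<noteq> p"
      using False by auto
    ultimately have "(f \<in> sd p J) \<noteq> (f \<in> p)"
      using pendant_separated[OF p] by blast
    then show ?thesis
      by auto
  qed simp
  show "OM_corner {f} (restr (fibre V p {f})) ((\<lambda>y. y \<inter> {f}) ` {p})"
    by (rule OM_corner_small[OF c]) simp_all
qed

text \<open>A further class is constant on the smaller cell, which shatters \<open>f\<close> and
  \<open>g\<close>; antipodes of the larger one would complete a triple.\<close>

lemma cell_maximal:
  assumes c: "cell V x K" and fg: "f \<in> K" "g \<in> K" "f \<noteq> g"
    and J: "cell V x J" "K \<subseteq> J"
  shows "J = K"
proof (rule ccontr)
  assume "J \<noteq> K"
  then obtain h where h: "h \<in> J" "h \<notin> K"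
    using J(2) by blast
  have "shatters3 V f g h"
  proof (rule shatters3_if_antipodal[OF cell_shatters2[OF iso_V finite_elem c fg]])
    show "(h \<in> t) = (h \<in> x)" if "t \<in> fibre V x K" for t
      using that h(2) by (simp add: fibre_iff)
    show "t \<in> V \<and> sd t J \<in> V" if "t \<in> fibre V x K" for t
    proof -
      have "t \<in> fibre V x J"
        using fibre_mono[OF J(2)] that by blast
      then show ?thesis
        using cell_fibre(1)[OF J(1)] by (simp add: fibre_iff)
    qed
  qed (use fg h J in blast)+
  then show False
    using rank2[of f g h] fg h by blast
qed

text \<open>Let \<open>j\<close> be a class of \<open>J\<close> outside \<open>K\<close>. A vertex
  of the \<open>J\<close>-cell that differs from \<open>x\<close> at \<open>j\<close> but not on
  \<open>J \<inter> K\<close> has the trace of \<open>x\<close>, which is excluded. It exists if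
  \<open>J \<inter> K\<close> has at most one element. With two elements, projecting the
  \<open>K\<close>-cell to the \<open>J\<close>-cell keeps them shattered with \<open>j\<close>
  constant, and \<open>J\<close>-antipodes complete a triple.\<close>

lemma cell_at_free_vertex:
  assumes c: "cell V x K" and cJ: "cell V x J" and free: "\<And>y. y \<in> V \<Longrightarrow> y \<inter> K = x \<inter> K \<Longrightarrow> y = x"
  shows "J \<subseteq> K"
proof (rule ccontr)
  assume "\<not> J \<subseteq> K"
  then obtain j where j: "j \<in> J" "j \<notin> K"
    by blast
  have no_flip: False if y: "y \<in> fibre V x J" "(j \<in> y) \<noteq> (j \<in> x)"
    "\<And>k. k \<in> J \<inter> K \<Longrightarrow> (k \<in> y) = (k \<in> x)" for y
  proof -
    have "(k \<in> y) = (k \<in> x)" if "k \<in> K" for k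
      using y(1,3) that unfolding fibre_iff by (cases "k \<in> J") auto
    then have "y = x"
      using free[of y] y(1) unfolding fibre_iff by blast
    then show False
      using y(2) by blast
  qed
  consider "J \<inter> K = {}" | k where "J \<inter> K = {k}" | k l where "k \<in> J \<inter> K" "l \<in> J \<inter> K" "k \<noteq> l"
    by blast
  then show False
  proof cases
    case 1
    have "(j \<in> sd x J) \<noteq> (j \<in> x)"
      using j by simp
    then show False
      using no_flip[of "sd x J"] cell_fibre(1)[OF cJ cell_self[OF cJ]] 1 by blast
  next
    case (2 k)
    then have "k \<in> J" "j \<noteq> k"
      using j by blast+
    then have "shatters2 (fibre V x J) j k"
      using cell_shatters2[OF iso_V finite_elem cJ j(1)] by blast
    then obtain y where "y \<in> fibre V x J" "(j \<in> y) = (j \<notin> x)" "(k \<in> y) = (k \<in> x)"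
      unfolding shatters2_def by blast
    then show False
      using no_flip[of y] 2 by auto
  next
    case (3 k l)
    have sh: "shatters2 (fibre V x K) k l"
      using cell_shatters2[OF iso_V finite_elem c] 3 by blast
    have projJ: "proj x J t \<in> fibre V x J" if "t \<in> V" for t
      using gate[OF cJ that] by (simp add: fibre_iff)
    have "shatters3 V k l j"
    proof (rule shatters3_if_antipodal)
      show "shatters2 (proj x J ` fibre V x K) k l"
        unfolding shatters2_def
      proof (intro allI)
        fix p q
        obtain t where "t \<in> fibre V x K" "(k \<in> t) = p" "(l \<in> t) = q"
          using sh unfolding shatters2_def by blast
        then show "\<exists>x\<in>proj x J ` fibre V x K. (k \<in> x) = p \<and> (l \<in> x) = q"
          using 3 by (intro bexI[of _ "proj x J t"]) auto
      qed
      show "(j \<in> u) = (j \<in> x)" if "u \<in> proj x J ` fibre V x K" for u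
        using that j by (auto simp: fibre_iff)
      show "u \<in> V \<and> sd u J \<in> V" if u: "u \<in> proj x J ` fibre V x K" for u
      proof -
        from u obtain t where t: "u = proj x J t" "t \<in> fibre V x K"
          by (rule imageE)
        then have "u \<in> fibre V x J"
          using projJ by (simp add: fibre_iff)
        then show ?thesis
          using cell_fibre(1)[OF cJ] by (simp add: fibre_def)
      qed
    qed (use 3 j in blast)+
    then show False
      using rank2[of k l j] 3 j by blast
  qed
qed

text \<open>What remains of the cycle runs from \<open>b = flip f a\<close> across \<open>f\<close>
  to \<open>flip f z\<close> and then to \<open>z\<close>, the antipode of \<open>b\<close>. It
  serves as the path \<open>H\<close> of \<open>antipodal_cycle\<close>, and the arc is its
  complement.\<close>

lemma OM_corner_wedge:
  assumes fw: "free_wedge V a z f" and K: "K = insert f (sd a z)"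
  shows "OM_corner K (restr (fibre V a K)) ((\<lambda>y. y \<inter> K) ` arc V a z)"
proof -
  have w: "wedge V a z f"
    using fw by (simp add: free_wedge_def)
  have az: "a \<in> V" "z \<in> V" "flip f a \<in> V" "flip f z \<in> V" "(f \<in> a) = (f \<in> z)" "a \<noteq> z"
    and c: "cell V a K"
    using w by (auto simp: wedge_def K simp del: mem_sd)
  let ?L = "fibre V a K" and ?r = "\<lambda>y. y \<inter> K"
  define M where "M = ?L - arc V a z"
  define b where "b = flip f a"
  have fK: "f \<in> K"
    by (simp add: K)
  have arcL: "x \<in> ?L" "(f \<in> x) = (f \<in> a)" if "x \<in> arc V a z" for x
  proof -
    have x: "x \<in> V" "btw a x z"
      using that by (auto simp: arc_def)
    show "(f \<in> x) = (f \<in> a)"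
      using btwD[OF x(2), of f] az(5) by blast
    show "x \<in> ?L"
      using x btw_Diff[OF x(2), of K] unfolding fibre_def K by blast
  qed
  have side: "btw a x z" if "x \<in> ?L" "(f \<in> x) = (f \<in> a)" for x
  proof (rule btwI)
    fix k assume "(k \<in> a) = (k \<in> z)"
    then show "(k \<in> x) = (k \<in> a)"
      using that by (cases "k = f") (auto simp: fibre_iff K)
  qed
  have opp: "sd x K \<in> ?L" if "x \<in> ?L" for x
    by (rule cell_fibre(1)[OF c that])
  have bz: "sd b K = z"
    using az(5) by (auto simp: b_def K)
  have zL: "z \<in> M"
    using az by (auto simp: M_def fibre_iff K arc_def)
  have bL: "b \<in> M"
    using az arcL(2)[of b] by (auto simp: M_def fibre_iff K b_def)
  have M_other: "x = z \<or> (f \<in> x) \<noteq> (f \<in> a)" if "x \<in> M" for x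
    using side[of x] that by (auto simp: M_def arc_def fibre_iff)
  have eqL: "x = y" if "x \<in> ?L" "y \<in> ?L" "?r x = ?r y" for x y
  proof -
    have "(k \<in> x) = (k \<in> y)" for k
      using that(1,2) Int_eqD[OF that(3), of k] by (cases "k \<in> K") (simp_all add: fibre_iff)
    then show ?thesis
      by blast
  qed
  have M_sub: "M \<subseteq> ?L"
    by (auto simp: M_def)
  have chainM: "sd x b \<subseteq> sd y b \<or> sd y b \<subseteq> sd x b" if xy: "x \<in> M" "y \<in> M" for x y
  proof -
    \<comment> \<open>\<open>z\<close> is the top of the chain, being antipodal to
      \<open>b\<close>.\<close>
    have sub: "sd u b \<subseteq> sd z b" if "u \<in> M" for u
    proof
      fix k assume "k \<in> sd u b"
      moreover have "b \<in> ?L" "u \<in> ?L"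
        using bL that M_sub by blast+
      ultimately have "k \<in> K"
        unfolding fibre_iff by auto
      then show "k \<in> sd z b"
        using bz[symmetric] by simp
    qed
    show ?thesis
    proof (cases "x = z \<or> y = z")
      case True
      then show ?thesis
        using sub xy by blast
    next
      case False
      \<comment> \<open>Antipodes carry the vertices across \<open>f\<close> to the interval of
        \<open>wedge_chain\<close>; complements in \<open>K - {f}\<close> reverse that
        chain.\<close>
      have flip_side: "sd u K \<in> V \<and> btw a (sd u K) z" if u: "u \<in> M" "u \<noteq> z" for u
      proof -
        have "sd u K \<in> ?L"
          using opp u M_sub by blast
        moreover have "(f \<in> sd u K) = (f \<in> a)"
          using M_other[OF u(1)] u(2) fK by auto
        ultimately show ?thesis
          using side unfolding fibre_iff by blast
      qed
      have "sd (sd x K) a \<subseteq> sd (sd y K) a \<or> sd (sd y K) a \<subseteq> sd (sd x K) a"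
        using wedge_chain[OF w] flip_side[OF xy(1)] flip_side[OF xy(2)] False by blast
      moreover have "sd (sd u K) a = K - {f} - sd u b" "sd u b \<subseteq> K - {f}" if u: "u \<in> M" "u \<noteq> z" for u
      proof -
        have uL: "u \<in> ?L" "(f \<in> u) \<noteq> (f \<in> a)"
          using u M_sub M_other by blast+
        have "k \<in> sd (sd u K) a \<longleftrightarrow> k \<in> K - {f} - sd u b" for k
          using fK uL by (cases "k \<in> K"; cases "k = f") (auto simp: b_def fibre_iff)
        then show "sd (sd u K) a = K - {f} - sd u b"
          by (rule set_eqI)
        have "k \<notin> sd u b" if "k \<notin> K - {f}" for k
          using that fK uL by (cases "k = f") (auto simp: b_def fibre_iff)
        then show "sd u b \<subseteq> K - {f}"
          by (metis subsetI)
      qed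
      then have "sd (sd x K) a = K - {f} - sd x b" "sd x b \<subseteq> K - {f}"
        "sd (sd y K) a = K - {f} - sd y b" "sd y b \<subseteq> K - {f}"
        using False xy by (simp_all del: mem_sd)
      ultimately show ?thesis
        by (metis Diff_mono double_diff subset_refl)
    qed
  qed
  have r_sd: "sd (?r x) (?r y) = sd x y" if "x \<in> ?L" "y \<in> ?L" for x y
  proof (rule set_eqI)
    fix k
    show "k \<in> sd (?r x) (?r y) \<longleftrightarrow> k \<in> sd x y"
      using that unfolding fibre_iff by (cases "k \<in> K") auto
  qed
  have r_opp: "?r (sd x K) = sd (?r x) K" for x
    by auto
  interpret cyc: antipodal_cycle K "?r ` ?L" "?r ` M" "?r b"
  proof
    show "partial_cube K (?r ` ?L)" "antipodal K (?r ` ?L)"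
      using partial_cube_restr_fibre[OF iso_V finite_elem c] by (simp_all add: restr_fibre[OF c])
    show "\<not> shatters3 (?r ` ?L) f g h" if "f \<noteq> g" "f \<noteq> h" "g \<noteq> h" for f g h
      by (rule no_shatters3_restr[OF that])
    show "K \<noteq> {}"
      using fK by blast
    show "K \<noteq> {j}" for j
    proof
      assume "K = {j}"
      then have "sd a z \<subseteq> {f}" "f \<notin> sd a z"
        using fK az(5) by (auto simp: K)
      then show False
        using sd_neq_empty[OF az(6)] by blast
    qed
    show "?r b \<in> ?r ` M"
      using bL by blast
    show "sd (?r b) K \<in> ?r ` M"
      using zL bz r_opp[of b] by (metis image_eqI)
    show "sd x (?r b) \<subseteq> sd y (?r b) \<or> sd y (?r b) \<subseteq> sd x (?r b)" if "x \<in> ?r ` M" "y \<in> ?r ` M" for x y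
    proof -
      from that(1) obtain u where u: "x = ?r u" "u \<in> M"
        by (rule imageE)
      from that(2) obtain v where v: "y = ?r v" "v \<in> M"
        by (rule imageE)
      show ?thesis
        using chainM[OF u(2) v(2)] r_sd u v bL subsetD[OF M_sub] by simp
    qed
    have "iso M"
    proof -
      have "M = fibre (V - arc V a z) a K"
        by (auto simp: M_def fibre_def)
      then show ?thesis
        using conv_iso[OF free_wedge_remove_iso[OF fw] conv_fibre] by simp
    qed
    then show "iso (?r ` M)"
      by (rule iso_image_Int) (use M_sub in \<open>auto simp: fibre_iff subset_iff\<close>)
    show "?r ` ?L = ?r ` M \<union> (\<lambda>x. sd x K) ` ?r ` M"
    proof
      show "?r ` ?L \<subseteq> ?r ` M \<union> (\<lambda>x. sd x K) ` ?r ` M"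
      proof
        fix u assume "u \<in> ?r ` ?L"
        then obtain x where x: "u = ?r x" "x \<in> ?L"
          by (rule imageE)
        show "u \<in> ?r ` M \<union> (\<lambda>x. sd x K) ` ?r ` M"
        proof (cases "x \<in> M")
          case True
          then show ?thesis
            using x by blast
        next
          case False
          then have "x \<in> arc V a z"
            using x by (simp add: M_def)
          then have "(f \<in> sd x K) \<noteq> (f \<in> a)"
            using arcL(2) fK by simp
          then have "sd x K \<in> M"
            using opp[OF x(2)] arcL(2)[of "sd x K"] by (auto simp: M_def simp del: mem_sd)
          then have "sd (?r (sd x K)) K \<in> (\<lambda>x. sd x K) ` ?r ` M"
            by blast
          then show ?thesis
            using x(1) by (simp add: r_opp)
        qed
      qed
      have "sd (?r x) K \<in> ?r ` ?L" if "x \<in> M" for x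
        using opp[of x] that M_sub r_opp[of x] by (metis image_eqI subsetD)
      then show "?r ` M \<union> (\<lambda>x. sd x K) ` ?r ` M \<subseteq> ?r ` ?L"
        using M_sub by blast
    qed
  qed
  have "?r ` ?L - ?r ` M = ?r ` arc V a z"
  proof
    show "?r ` ?L - ?r ` M \<subseteq> ?r ` arc V a z"
      by (auto simp: M_def)
    show "?r ` arc V a z \<subseteq> ?r ` ?L - ?r ` M"
    proof
      fix u assume "u \<in> ?r ` arc V a z"
      then obtain x where x: "u = ?r x" "x \<in> arc V a z"
        by (rule imageE)
      have "u \<notin> ?r ` M"
      proof
        assume "u \<in> ?r ` M"
        then obtain y where y: "u = ?r y" "y \<in> M"
          by (rule imageE)
        then have "x = y"
          using eqL arcL(1)[OF x(2)] x(1) M_sub by blast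
        then show False
          using x y by (simp add: M_def)
      qed
      then show "u \<in> ?r ` ?L - ?r ` M"
        using x arcL(1) by blast
    qed
  qed
  then show ?thesis
    using cyc.OM_corner_cycle by (simp add: restr_fibre[OF c])
qed

lemma COM_corner_wedge:
  assumes fw: "free_wedge V a z f"
  shows "COM_corner V (arc V a z)"
proof -
  define K where "K = insert f (sd a z)"
  have c: "cell V a K" and az: "(f \<in> a) = (f \<in> z)" "a \<noteq> z"
    using fw by (auto simp: free_wedge_def wedge_def K_def simp del: mem_sd)
  have triv: "y = x" if "x \<in> arc V a z" "y \<in> V" "y \<inter> K = x \<inter> K" for x y
    using fw that unfolding free_wedge_def K_def by blast
  obtain g where "g \<in> sd a z"
    using sd_neq_empty[OF az(2)] by blast
  then have fg: "f \<in> K" "g \<in> K" "f \<noteq> g"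
    using az(1) by (auto simp: K_def)
  have arcL: "arc V a z \<subseteq> fibre V a K"
  proof
    fix x assume "x \<in> arc V a z"
    then show "x \<in> fibre V a K"
      using btw_Diff[of a x z K] unfolding arc_def fibre_def K_def by blast
  qed
  show ?thesis
  proof (rule COM_cornerI[OF c _ arcL])
    show "J = K" if "cell V a J" "K \<subseteq> J" for J
      by (rule cell_maximal[OF c fg that])
    show "J \<subseteq> K \<or> K \<subseteq> J" if y: "y \<in> arc V a z" and J: "cell V y J" for y J
      using cell_at_free_vertex[OF cell_fibre(3)[OF c] J triv[OF y]] y arcL by blast
    show "OM_corner K (restr (fibre V a K)) ((\<lambda>y. y \<inter> K) ` arc V a z)"
      by (rule OM_corner_wedge[OF fw K_def])
  qed
qed

lemma COM_corner_exists:
  assumes "V \<noteq> {}"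
  shows "\<exists>C. C \<noteq> {} \<and> C \<subseteq> V \<and> COM_corner V C \<and> com2 (V - C)"
proof -
  obtain x where "x \<in> V"
    using assms by blast
  then consider "V = {x}" | p f where "pendant V p f" | a z f where "free_wedge V a z f"
    using corner_exists by blast
  then show ?thesis
  proof cases
    case 1
    \<comment> \<open>The remaining set is empty, so all conditions hold trivially.\<close>
    have "com2 (V - {x})"
      using 1 by unfold_locales (auto simp: iso_def cell_def shatters3_def)
    then show ?thesis
      using COM_corner_singleton[OF 1] 1 by blast
  next
    case (2 p f)
    then show ?thesis
      using COM_corner_pendant pendant_remove by (intro exI[of _ "{p}"]) (auto simp: pendant_def)
  next
    case (3 a z f)
    then have "a \<in> arc V a z"
      by (simp add: free_wedge_def wedge_def arc_def)
    moreover have "arc V a z \<subseteq> V"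
      by (auto simp: arc_def)
    ultimately show ?thesis
      using COM_corner_wedge[OF 3] free_wedge_remove[OF 3] by blast
  qed
qed

end

section \<open>Induction over corner removals\<close>

lemma corner_peeling_Cons:
  assumes C: "C \<noteq> {}" "C \<subseteq> V" "COM_corner V C" and Cs: "corner_peeling (V - C) Cs"
  shows "corner_peeling V (C # Cs)"
  unfolding corner_peeling_def
proof (intro conjI allI impI ballI)
  have un: "\<Union>(set Cs) = V - C"
    using Cs by (simp add: corner_peeling_def)
  show "D \<noteq> {}" if "D \<in> set (C # Cs)" for D
    using that C(1) Cs by (auto simp: corner_peeling_def)
  show "\<Union>(set (C # Cs)) = V"
    using un C(2) by auto
  have disj: "C \<inter> Cs ! i = {}" if "i < length Cs" for i
    using un nth_mem[OF that] by blast
  show "(C # Cs) ! i \<inter> (C # Cs) ! j = {}"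
    if "i < length (C # Cs)" "j < length (C # Cs)" "i \<noteq> j" for i j
    using that disj Cs unfolding corner_peeling_def
    by (cases i; cases j) (auto simp: Int_commute)
  show "COM_corner (V - \<Union>(set (take i (C # Cs)))) ((C # Cs) ! i)" if "i < length (C # Cs)" for i
  proof (cases i)
    case 0
    then show ?thesis
      using C by simp
  next
    case (Suc n)
    have "V - \<Union>(set (take i (C # Cs))) = V - C - \<Union>(set (take n Cs))"
      using Suc by auto
    then show ?thesis
      using Cs that Suc unfolding corner_peeling_def by simp
  qed
qed

lemma corner_peeling_exists: "com2 V \<Longrightarrow> \<exists>Cs. corner_peeling V Cs"
proof (induction "card V" arbitrary: V rule: less_induct)
  case less
  interpret com2 V by fact
  show ?case
  proof (cases "V = {}")
    case True
    then show ?thesis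
      by (intro exI[of _ "[]"]) (simp add: corner_peeling_def)
  next
    case False
    then obtain C where C: "C \<noteq> {}" "C \<subseteq> V" "COM_corner V C" "com2 (V - C)"
      using COM_corner_exists by blast
    then have "V - C \<subset> V"
      by blast
    then have "card (V - C) < card V"
      by (rule psubset_card_mono[OF finite_V])
    then obtain Cs where "corner_peeling (V - C) Cs"
      using less.hyps C(4) by blast
    then show ?thesis
      using corner_peeling_Cons C by blast
  qed
qed

theorem mainTheorem12:
  fixes E :: "'a set" and V :: "'a set set"
  assumes "COM E V" and "rank E V = 2"
  shows "\<exists>Cs. corner_peeling V Cs"
  using corner_peeling_exists[OF COM_com2[OF assms]] .

end
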